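(* Let $N\ge 1$, $m\ge 2$, $k\ge 2$, $1\le l\le k-1$ be integers, put $n_i=l+(i-1)k$ for $i=1,\dots,N$, and let $W_N^{[m,k,l]}(z)$ be the generalized Wronskian--Hermite polynomial. Then every nonzero (complex) root of $W_N^{[m,k,l]}(z)$ is simple in each of the following cases: (i) $N=2$ and $m>n_1$; (ii) $N\ge 3$ and $m>n_N/2$; (iii) $k=4$ and $m=2$.
   Context: For an integer $m\ge 2$ the polynomials $p_n^{[m]}(z)$ are defined by $\sum_{n\ge 0}p_n^{[m]}(z)\epsilon^n=\exp(z\epsilon+\epsilon^m)$, with $p_n^{[m]}\equiv 0$ for $n<0$. The generalized Wronskian--Hermite polynomial with jump $k$ is $$W_N^{[m,k,l]}(z)=c_N^{[m,k,l]}\,\mathrm{Wr}\big[p_{n_1}^{[m]}(z),\dots,p_{n_N}^{[m]}(z)\big],\qquad c_N^{[m,k,l]}=\frac{\prod_{i=1}^N n_i!}{\prod_{1\le i<j\le N}(n_j-n_i)},$$ where $n_i=l+(i-1)k$ and $\mathrm{Wr}[f_1,\dots,f_N]=\det_{1\le i,j\le N}\big(d^{\,i-1}f_j/dz^{i-1}\big)$ is the Wronskian. *)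

theory Defs
  imports
    "HOL-Computational_Algebra.Computational_Algebra"
    "Jordan_Normal_Form.Determinant"
begin

text \<open>
  The series \<open>exp\<close> with coefficients in the ring of complex polynomials in \<open>z\<close>.  The library's
  \<open>fps_exp\<close> requires a coefficient field, so it cannot be used over \<open>complex poly\<close>.
\<close>

definition exp_series :: "complex poly fps" where
  "exp_series = Abs_fps (\<lambda>j. [:1 / fact j:])"

text \<open>
  The coefficient of \<open>\<epsilon>^n\<close> in \<open>exp (z \<epsilon> + \<epsilon>^m)\<close>, where \<open>\<epsilon>\<close> is \<open>fps_X\<close> and \<open>z\<close> is the polynomial
  \<open>[:0, 1:]\<close>.  The composition is meaningful because the inner series has no constant term
  (for \<open>m \<ge> 1\<close>).
\<close>

definition pgen :: "nat \<Rightarrow> nat \<Rightarrow> complex poly" where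
  "pgen m n = fps_nth (exp_series oo (fps_const [:0, 1:] * fps_X + fps_X ^ m)) n"

lemma poly_pgen:
  "poly (pgen m n) z = fps_nth (fps_exp 1 oo (fps_const z * fps_X + fps_X ^ m)) n"
proof -
  let ?F = "fps_const [:0, 1:] * fps_X + fps_X ^ m :: complex poly fps"
  let ?G = "fps_const z * fps_X + fps_X ^ m :: complex fps"
  have base: "poly (fps_nth ?F j) z = fps_nth ?G j" for j
    by (cases j) (auto simp: fps_X_power_nth)
  have pow: "poly (fps_nth (?F ^ i) j) z = fps_nth (?G ^ i) j" for i j
  proof (induction i arbitrary: j)
    case 0
    then show ?case by (simp add: fps_one_nth)
  next
    case (Suc i)
    show ?case
      by (simp only: power_Suc fps_mult_nth poly_sum poly_mult base Suc.IH)
  qed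
  show ?thesis
    unfolding pgen_def exp_series_def fps_compose_nth fps_nth_Abs_fps poly_sum poly_mult pow
    by (simp add: fps_exp_def)
qed

text \<open>
  The Wronskian of a list of polynomials; rows and columns are numbered from 0, so row \<open>i\<close>
  holds the \<open>i\<close>-th derivatives.
\<close>

definition wronskian :: "complex poly list \<Rightarrow> complex poly" where
  "wronskian fs = det (mat (length fs) (length fs) (\<lambda>(i, j). (pderiv ^^ i) (fs ! j)))"

text \<open>The indices \<open>n\<^sub>i\<close>, for \<open>i \<ge> 1\<close>.\<close>

definition jump_index :: "nat \<Rightarrow> nat \<Rightarrow> nat \<Rightarrow> nat" where
  "jump_index k l i = l + (i - 1) * k"

definition wh_const :: "nat \<Rightarrow> nat \<Rightarrow> nat \<Rightarrow> complex" where
  "wh_const N k l =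
     (\<Prod>i = 1..N. fact (jump_index k l i)) /
     (\<Prod>(i, j) \<in> {(i, j). 1 \<le> i \<and> i < j \<and> j \<le> N}.
        of_nat (jump_index k l j) - of_nat (jump_index k l i))"

definition WH_poly :: "nat \<Rightarrow> nat \<Rightarrow> nat \<Rightarrow> nat \<Rightarrow> complex poly" where
  "WH_poly N m k l =
     Polynomial.smult (wh_const N k l)
       (wronskian (map (\<lambda>i. pgen m (jump_index k l i)) [1..<N + 1]))"

end

(*
  Write [.]_i for falling factorials and D = d/dz; p_n' = p_(n-1).

  (i) For N = 2 and m > n_1 we have p_(n_1) = z^(n_1)/n_1!, and writing p_(n_2) = z^r F(z^m) the
  Wronskian is a monomial times G(z^m) with G = (r - n_1) F + m x F'. Up to reflection, F arises
  from (x - m)^M by the multipliers x^i -> x^i / prod_(t<i) (b + m t), each of which turns a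
  polynomial with positive roots into one with simple positive roots; G then alternates in sign
  along the roots of F and one point near infinity, so its roots are real and simple.

  (ii) For n_N < 2m each p_n has at most two terms, and W is a monomial times det (z^m + A), where
  A maps the values at the n_j of a polynomial q of degree < N to the numbers b_j q(u_j), u_j = n_j - m.
  If k divides m, A is nilpotent. Otherwise, up to signs, A is on its support a Cauchy matrix
  1 / (n_p - u_j) scaled by positive factors, so it diminishes the number of sign changes.
  A non-real eigenvalue or a double real one would give a two-dimensional space of vectors
  in which the number of sign changes recurs under iteration of A, yet drops strictly at a vector
  whose last entry vanishes.

  (iii) For m = 2, k = 4 the span V of the p_(n_i) is invariant under L = z D + 2 D^2 and D^4, hence
  under L^2 - 4 D^4 = 4 z D^3 + (z^2 + 4) D^2 + z D. At a point z <> 0 the set of vanishing orders of V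
  has at most N elements and is closed under subtracting 2 and 3, so it is {0..N-1} or {0..N-2, N}.
*)

theory Submission
  imports Defs "Jordan_Normal_Form.Char_Poly"
begin

subsection \<open>The polynomials \<open>p\<^sub>n\<close>\<close>

text \<open>(i) The factors of \<open>fact (r + m * i)\<close> fall into \<open>m\<close> residue
  classes modulo \<open>m\<close>. The class of \<open>m\<close> itself combines with
  \<open>fact (M - i)\<close> into the binomial coefficients of (x - m)^M; each of the other
  \<open>m - 1\<close> classes is a multiplier. The first multiplier already splits the M-fold root.
  (ii) Zero entries make the number of sign changes ambiguous, so two counts are carried: zeros
  dropped (\<open>strictly_alternates\<close>) or signed as favourably as possible
  (\<open>weakly_alternates\<close>). The Cauchy kernel bounds the larger count of the image by the
  smaller count of the argument. Small perturbations can only raise the smaller count and lower the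
  larger one, so an approximate recurrence suffices. A zero last entry opens a gap between the
  counts, and a two-dimensional space always contains a nonzero vector with such a zero. (iii) The
  vanishing of W, or of W', at a point gives a nonzero element of V whose vanishing order avoids N
  prescribed values. Together they force both N and N - 1 to occur, hence all of 0..N, one more than
  dim V allows.\<close>

lemma fps_deriv_eq_mult_unique:
  fixes f g h :: "'a::field_char_0 fps"
  assumes "fps_deriv f = f * h" "fps_deriv g = g * h" "fps_nth f 0 = fps_nth g 0"
  shows "f = g"
proof (rule fps_ext)
  fix n
  show "fps_nth f n = fps_nth g n"
  proof (induction n rule: less_induct)
    case (less n)
    show ?case
    proof (cases n)
      case 0
      then show ?thesis using assms(3) by simp
    next
      case (Suc j)
      have "fps_nth (f * h) j = fps_nth (g * h) j"
        unfolding fps_mult_nth by (intro sum.cong refl) (use less Suc in auto)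
      then have "fps_nth (fps_deriv f) j = fps_nth (fps_deriv g) j"
        using assms by simp
      then have "of_nat (Suc j) * fps_nth f (Suc j) = of_nat (Suc j) * fps_nth g (Suc j)"
        unfolding fps_deriv_nth Suc_eq_plus1 .
      then show ?thesis using Suc by (simp del: of_nat_Suc)
    qed
  qed
qed

text \<open>Both sides solve f' = f h with the same h and initial value 1. The product form
  separates \<open>z\<close> from \<open>m\<close>, so coefficients can be read off.\<close>

lemma fps_exp_compose_linear_plus_power:
  fixes z :: "'a::field_char_0"
  assumes "m \<ge> 1"
  shows "fps_exp 1 oo (fps_const z * fps_X + fps_X ^ m) = fps_exp z * (fps_exp 1 oo fps_X ^ m)"
proof (rule fps_deriv_eq_mult_unique)
  let ?h = "fps_const z + fps_deriv (fps_X ^ m) :: 'a fps"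
  have 0: "fps_nth (fps_const z * fps_X + fps_X ^ m) 0 = 0" "fps_nth (fps_X ^ m :: 'a fps) 0 = 0"
    using assms by (auto simp: fps_X_power_nth)
  show "fps_deriv (fps_exp 1 oo (fps_const z * fps_X + fps_X ^ m)) =
      (fps_exp 1 oo (fps_const z * fps_X + fps_X ^ m)) * ?h"
    using fps_compose_deriv[OF 0(1), of "fps_exp 1"] by simp
  show "fps_deriv (fps_exp z * (fps_exp 1 oo fps_X ^ m)) = fps_exp z * (fps_exp 1 oo fps_X ^ m) * ?h"
    using fps_compose_deriv[OF 0(2), of "fps_exp 1"] by (simp add: algebra_simps)
qed simp

lemma coeff_pgen:
  assumes "m \<ge> 1"
  shows "coeff (pgen m n) d =
    (if d \<le> n \<and> m dvd n - d then 1 / (fact d * fact ((n - d) div m)) else 0)"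
proof -
  let ?p = "\<Sum>i\<le>n. monom (if m dvd n - i then 1 / (fact i * fact ((n - i) div m)) else 0) i :: complex poly"
  have "poly (pgen m n) z = poly ?p z" for z
  proof -
    have "poly (pgen m n) z = (\<Sum>i=0..n. (z ^ i / fact i) *
        (if m dvd n - i then 1 / fact ((n - i) div m) else 0))"
      unfolding poly_pgen fps_exp_compose_linear_plus_power[OF assms] fps_mult_nth
      using assms by (intro sum.cong) (auto simp: fps_nth_compose_X_power)
    also have "\<dots> = poly ?p z"
      by (auto simp: poly_sum poly_monom atLeast0AtMost intro!: sum.cong)
    finally show ?thesis .
  qed
  then have "pgen m n = ?p" by (intro poly_eq_poly_eq_iff[THEN iffD1] ext)
  then show ?thesis by (auto simp: coeff_sum)
qed

lemma pderiv_pgen: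
  assumes "m \<ge> 1"
  shows "pderiv (pgen m (Suc n)) = pgen m n" "pderiv (pgen m 0) = 0"
  using assms by (auto intro!: poly_eqI simp: coeff_pderiv coeff_pgen field_simps simp del: of_nat_Suc)

lemma pderiv_funpow_pgen:
  assumes "m \<ge> 1"
  shows "(pderiv ^^ i) (pgen m n) = (if i \<le> n then pgen m (n - i) else 0)"
proof (induction i)
  case (Suc i)
  show ?case
  proof (cases "i < n")
    case True
    then have "n - i = Suc (n - Suc i)" by simp
    with Suc True show ?thesis by (simp add: pderiv_pgen[OF assms])
  next
    case False
    with Suc show ?thesis by (cases "i = n") (simp_all add: pderiv_pgen[OF assms])
  qed
qed simp

text \<open>Applying epsilon d/d epsilon to the generating function gives n p_n = z p_(n-1) + 2
  p_(n-2), which is this equation since p_n' = p_(n-1).\<close>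

lemma pgen_euler_hermite:
  "[:0, 1:] * pderiv (pgen 2 n) + Polynomial.smult 2 (pderiv (pderiv (pgen 2 n))) = Polynomial.smult (of_nat n) (pgen 2 n)"
proof (rule poly_eqI)
  fix d
  have *: "coeff (pderiv (pderiv (pgen 2 n))) d = of_nat (d+1) * of_nat (d+2) * coeff (pgen 2 n) (d+2)"
    by (simp add: coeff_pderiv)
  have 1: "coeff ([:0, 1:] * pderiv (pgen 2 n)) d = of_nat d * coeff (pgen 2 n) d"
    by (cases d) (auto simp: coeff_pderiv coeff_pCons)
  show "coeff ([:0, 1:] * pderiv (pgen 2 n) + Polynomial.smult 2 (pderiv (pderiv (pgen 2 n)))) d =
      coeff (Polynomial.smult (of_nat n) (pgen 2 n)) d"
  proof (cases "d \<le> n \<and> even (n - d)")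
    case False
    then have "\<not> (d + 2 \<le> n \<and> even (n - (d + 2)))" by auto
    then have "coeff (pgen 2 n) (d+2) = 0" "coeff (pgen 2 n) d = 0"
      using False by (auto simp: coeff_pgen)
    then show ?thesis unfolding coeff_add coeff_smult * 1 by simp
  next
    case True
    then obtain e where e: "n = d + 2 * e" by (metis dvdE le_add_diff_inverse)
    show ?thesis
    proof (cases e)
      case 0
      then show ?thesis unfolding coeff_add coeff_smult * 1 using e by (simp add: coeff_pgen)
    next
      case (Suc e')
      have "coeff (pgen 2 n) (d+2) = 1 / (fact (d+2) * fact e')" "coeff (pgen 2 n) d = 1 / (fact d * fact (Suc e'))"
        using e Suc by (simp_all add: coeff_pgen del: fact_Suc)
      moreover have "of_nat d / (fact d * fact (Suc e')) + 2 * (of_nat (d+1) * of_nat (d+2) / (fact (d+2) * fact e')) = 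
        (of_nat n :: complex) / (fact d * fact (Suc e'))"
      proof -
        have f: "fact (d+2) = of_nat (d+1) * of_nat (d+2) * (fact d :: complex)" "fact (Suc e') = of_nat (Suc e') * (fact e' :: complex)"
          by (simp_all add: algebra_simps)
        have nz: "of_nat (d+1) \<noteq> (0::complex)" "of_nat (d+2) \<noteq> (0::complex)" "of_nat (Suc e') \<noteq> (0::complex)"
          by (simp_all del: of_nat_Suc of_nat_add)
        have "n = d + 2 * Suc e'" using e Suc by simp
        then have n: "(of_nat n :: complex) = of_nat d + 2 * of_nat (Suc e')" by simp
        show ?thesis unfolding f n using nz by (simp add: divide_simps del: of_nat_Suc of_nat_add)
      qed
      ultimately show ?thesis unfolding coeff_add coeff_smult * 1 by (simp del: fact_Suc of_nat_Suc)
    qed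
  qed
qed

lemma order_eq_1I:
  fixes p :: "'a::field_char_0 poly"
  assumes "poly p z = 0" "poly (pderiv p) z \<noteq> 0"
  shows "Polynomial.order z p = 1"
proof -
  have "p \<noteq> 0" using assms(2) by auto
  moreover have "Polynomial.order z p \<noteq> 0" using assms(1) \<open>p \<noteq> 0\<close> by (simp add: order_root)
  moreover have "Polynomial.order z (pderiv p) = 0" using assms(2) by (simp add: order_0I)
  ultimately show ?thesis using assms by (subst order_pderiv) auto
qed

text \<open>At a nonzero point powers of z are units and z -> z^m has nonzero derivative, so a
  double root is passed on to \<open>q\<close>. The factor \<open>monom 1 b\<close> is there because
  clearing powers of z in the determinant multiplies the Wronskian by such a factor.\<close>

lemma double_root_pcompose_monom:
  fixes w q :: "'a::field_char_0 poly"
  assumes eq: "w * monom 1 b = Polynomial.smult C (monom 1 a * pcompose q (monom 1 m))"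
    and "C \<noteq> 0" "z \<noteq> 0" "m \<ge> 1" and w: "poly w z = 0" "poly (pderiv w) z = 0"
  shows "poly q (z ^ m) = 0" "poly (pderiv q) (z ^ m) = 0"
proof -
  have "poly (w * monom 1 b) z = 0" using w by simp
  then show q: "poly q (z ^ m) = 0"
    unfolding eq using assms by (simp add: poly_pcompose poly_monom)
  have "poly (pderiv (w * monom 1 b)) z = 0" using w by (simp add: pderiv_mult)
  then show "poly (pderiv q) (z ^ m) = 0"
    unfolding eq using assms q by (simp add: poly_pcompose poly_monom pderiv_mult pderiv_smult pderiv_pcompose pderiv_monom)
qed

subsection \<open>Wronskians and vanishing orders\<close>

lemma det_mat_eq_0_kernel:
  fixes f :: "nat \<Rightarrow> nat \<Rightarrow> 'a::field"
  assumes "det (mat n n (\<lambda>(i, j). f i j)) = 0"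
  obtains c where "\<exists>j<n. c j \<noteq> 0" "\<And>i. i < n \<Longrightarrow> (\<Sum>j<n. f i j * c j) = 0"
proof -
  let ?A = "mat n n (\<lambda>(i, j). f i j)"
  obtain v where v: "v \<in> carrier_vec n" "v \<noteq> 0\<^sub>v n" "?A *\<^sub>v v = 0\<^sub>v n"
    using det_0_iff_vec_prod_zero[of ?A n] assms by auto
  show ?thesis
  proof (rule that[of "\<lambda>j. v $ j"])
    show "\<exists>j<n. v $ j \<noteq> 0"
      using v by (metis carrier_vecD eq_vecI index_zero_vec(1) index_zero_vec(2))
    fix i assume i: "i < n"
    then have "(?A *\<^sub>v v) $ i = 0" using v by simp
    then show "(\<Sum>j<n. f i j * v $ j) = 0"
      using i v(1) by (simp add: scalar_prod_def atLeast0LessThan)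
  qed
qed

lemma poly_det_mat:
  "poly (det (mat n n (\<lambda>(i, j). f i j))) z = det (mat n n (\<lambda>(i, j). poly (f i j) z))"
  by (rule poly_det_cong[of _ n]) auto

text \<open>The product rule in each permutation term, regrouped by the row that is
  differentiated.\<close>

lemma pderiv_det:
  fixes A :: "'a::idom poly mat"
  assumes A: "A \<in> carrier_mat n n"
  shows "pderiv (det A) =
    (\<Sum>i<n. det (mat n n (\<lambda>(a, b). if a = i then pderiv (A $$ (a, b)) else A $$ (a, b))))"
proof -
  let ?P = "{p. p permutes {0..<n}}"
  let ?B = "\<lambda>i. mat n n (\<lambda>(a, b). if a = i then pderiv (A $$ (a, b)) else A $$ (a, b))"
  have sg: "pderiv (signof p * q) = signof p * pderiv q" for p and q :: "'a poly"
    by (cases p rule: sign_cases) (simp_all add: pderiv_minus)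
  have "pderiv (det A) = (\<Sum>p\<in>?P. signof p *
      (\<Sum>i\<in>{0..<n}. prod (\<lambda>a. A $$ (a, p a)) ({0..<n} - {i}) * pderiv (A $$ (i, p i))))"
    unfolding det_def'[OF A] pderiv_sum sg pderiv_prod ..
  also have "\<dots> = (\<Sum>p\<in>?P. \<Sum>i<n. signof p * (\<Prod>a = 0..<n. ?B i $$ (a, p a)))"
  proof (intro sum.cong refl)
    fix p assume p: "p \<in> ?P"
    have pa: "p a < n" if "a < n" for a using p that permutes_in_image[of p "{0..<n}" a] by auto
    have "(\<Prod>a = 0..<n. ?B i $$ (a, p a)) =
        prod (\<lambda>a. A $$ (a, p a)) ({0..<n} - {i}) * pderiv (A $$ (i, p i))" if i: "i < n" for i
    proof -
      have "(\<Prod>a = 0..<n. ?B i $$ (a, p a)) = ?B i $$ (i, p i) * (\<Prod>a \<in> {0..<n} - {i}. ?B i $$ (a, p a))"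
        using i by (subst prod.remove[of _ i]) auto
      moreover have "(\<Prod>a \<in> {0..<n} - {i}. ?B i $$ (a, p a)) = prod (\<lambda>a. A $$ (a, p a)) ({0..<n} - {i})"
        by (intro prod.cong refl) (use pa in auto)
      ultimately show ?thesis using i pa by (simp add: mult.commute)
    qed
    then show "signof p * (\<Sum>i\<in>{0..<n}. prod (\<lambda>a. A $$ (a, p a)) ({0..<n} - {i}) * pderiv (A $$ (i, p i))) =
      (\<Sum>i<n. signof p * (\<Prod>a = 0..<n. ?B i $$ (a, p a)))"
      by (simp add: sum_distrib_left atLeast0LessThan)
  qed
  also have "\<dots> = (\<Sum>i<n. \<Sum>p\<in>?P. signof p * (\<Prod>a = 0..<n. ?B i $$ (a, p a)))"
    by (rule sum.swap)
  also have "\<dots> = (\<Sum>i<n. det (?B i))"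
    by (intro sum.cong refl, subst det_def'[of _ n]) auto
  finally show ?thesis .
qed

text \<open>Differentiating any row but the last one produces two equal rows.\<close>

lemma pderiv_wronskian:
  assumes "length fs = Suc n"
  shows "pderiv (wronskian fs) =
    det (mat (Suc n) (Suc n) (\<lambda>(i, j). (pderiv ^^ (if i = n then Suc n else i)) (fs ! j)))"
proof -
  let ?A = "mat (Suc n) (Suc n) (\<lambda>(i, j). (pderiv ^^ i) (fs ! j))"
  let ?B = "\<lambda>i. mat (Suc n) (Suc n) (\<lambda>(a, b). if a = i then pderiv (?A $$ (a, b)) else ?A $$ (a, b))"
  have z: "det (?B i) = 0" if "i < n" for i
    by (rule det_identical_rows[of _ "Suc n" i "Suc i"]) (use that in \<open>auto intro!: eq_vecI\<close>)
  have "pderiv (wronskian fs) = (\<Sum>i<Suc n. det (?B i))"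
    unfolding wronskian_def assms by (rule pderiv_det) auto
  also have "\<dots> = det (?B n)" using z by simp
  also have "?B n = mat (Suc n) (Suc n) (\<lambda>(i, j). (pderiv ^^ (if i = n then Suc n else i)) (fs ! j))"
    by (intro eq_matI) auto
  finally show ?thesis .
qed

text \<open>A nonzero \<open>v\<close> makes the order of \<open>f\<close> at \<open>a\<close>
  exactly \<open>e\<close>; with \<open>v = 0\<close> there is only divisibility by the power.
  Allowing 0 lets leading coefficients add and scale without a case distinction on
  cancellation.\<close>

definition leads :: "'a::comm_ring_1 \<Rightarrow> nat \<Rightarrow> 'a \<Rightarrow> 'a poly \<Rightarrow> bool" where
  "leads a e v f \<longleftrightarrow> (\<exists>g. f = [:- a, 1:] ^ e * g \<and> poly g a = v)"

lemma leads_add: "leads a e v f \<Longrightarrow> leads a e w g \<Longrightarrow> leads a e (v + w) (f + g)"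
  unfolding leads_def by (metis distrib_left poly_add)

lemma leads_mult: "leads a e v f \<Longrightarrow> leads a e (poly q a * v) (q * f)"
  unfolding leads_def by (metis mult.left_commute poly_mult)

lemma leads_smult: "leads a e v f \<Longrightarrow> leads a e (c * v) (Polynomial.smult c f)"
  using leads_mult[of a e v f "[:c:]"] by simp

lemma leads_Suc: "leads a (Suc e) v f \<Longrightarrow> leads a e 0 f"
  unfolding leads_def power_Suc2 mult.assoc
  by (metis mult_eq_0_iff poly_mult poly_eq_0_iff_dvd dvd_triv_left)

lemma leads_pderiv:
  fixes a :: "'a::idom"
  assumes "leads a (Suc e) v f"
  shows "leads a e (of_nat (Suc e) * v) (pderiv f)"
proof -
  obtain g where g: "f = [:- a, 1:] ^ Suc e * g" "poly g a = v"
    using assms unfolding leads_def by auto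
  have "pderiv f = [:- a, 1:] ^ e * (of_nat (Suc e) * g + [:- a, 1:] * pderiv g)"
    unfolding g(1) pderiv_mult pderiv_power_Suc
    by (simp add: pderiv_pCons algebra_simps of_nat_poly)
  then show ?thesis using g(2) unfolding leads_def by (auto simp: of_nat_poly)
qed

lemma leads_funpow_pderiv:
  fixes a :: "'a::idom"
  shows "leads a (e + d) v f \<Longrightarrow> leads a e ((\<Prod>i<d. of_nat (e + d - i)) * v) ((pderiv ^^ d) f)"
proof (induction d arbitrary: v f)
  case (Suc d)
  from leads_pderiv[of a "e + d" v f] Suc.prems
  have "leads a (e + d) (of_nat (Suc (e + d)) * v) (pderiv f)" by simp
  from Suc.IH[OF this] show ?case
    by (simp only: funpow_Suc_right o_apply prod.lessThan_Suc_shift) (simp add: mult_ac)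
qed simp

lemma leads_exists:
  fixes f :: "'a::idom poly"
  assumes "f \<noteq> 0"
  obtains e v where "v \<noteq> 0" "leads a e v f"
  using order_decomp[OF assms, of a] unfolding leads_def poly_eq_0_iff_dvd[symmetric] by metis

lemma leads_poly_funpow_pderiv:
  fixes a :: "'a::{idom, ring_char_0}"
  assumes "leads a e v f" "v \<noteq> 0"
  shows "poly ((pderiv ^^ e) f) a \<noteq> 0"
proof -
  have "leads a 0 ((\<Prod>i<e. of_nat (e - i)) * v) ((pderiv ^^ e) f)"
    using leads_funpow_pderiv[of a 0 e v f] assms by simp
  then show ?thesis using assms(2) by (auto simp: leads_def)
qed

text \<open>Modulo the power one above the least order with nonzero coefficient, only that single
  term survives.\<close>

lemma leads_sum_distinct:
  fixes a :: "'a::idom"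
  assumes "finite E" "\<And>e. e \<in> E \<Longrightarrow> v e \<noteq> 0 \<and> leads a e (v e) (f e)"
    and "(\<Sum>e\<in>E. Polynomial.smult (c e) (f e)) = 0" "e \<in> E"
  shows "c e = 0"
proof (rule ccontr)
  assume "c e \<noteq> 0"
  define d where "d = Min {e \<in> E. c e \<noteq> 0}"
  have d: "d \<in> E" "c d \<noteq> 0" "\<And>x. x \<in> E \<Longrightarrow> x < d \<Longrightarrow> c x = 0"
    using Min_in[of "{e \<in> E. c e \<noteq> 0}"] Min_le[of "{e \<in> E. c e \<noteq> 0}"] assms(1,4) \<open>c e \<noteq> 0\<close>
    unfolding d_def by (auto simp: not_less[symmetric])
  have "\<forall>e\<in>E - {d}. [:- a, 1:] ^ Suc d dvd Polynomial.smult (c e) (f e)"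
  proof
    fix e assume e: "e \<in> E - {d}"
    show "[:- a, 1:] ^ Suc d dvd Polynomial.smult (c e) (f e)"
    proof (cases "e < d")
      case False
      then have "[:- a, 1:] ^ Suc d dvd [:- a, 1:] ^ e" using e by (intro le_imp_power_dvd) auto
      then show ?thesis using assms(2)[of e] e unfolding leads_def
        by (metis DiffD1 dvd_mult2 dvd_smult)
    qed (use d(3) e in auto)
  qed
  then have "[:- a, 1:] ^ Suc d dvd (\<Sum>e\<in>E - {d}. Polynomial.smult (c e) (f e))" by (intro dvd_sum) auto
  moreover have "(\<Sum>e\<in>E - {d}. Polynomial.smult (c e) (f e)) = - Polynomial.smult (c d) (f d)"
    using assms(3) d(1) assms(1) by (simp add: sum.remove eq_neg_iff_add_eq_0 add.commute)
  ultimately have "[:- a, 1:] ^ Suc d dvd Polynomial.smult (c d) (f d)" by simp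
  moreover obtain g where "f d = [:- a, 1:] ^ d * g" "poly g a = v d" using assms(2)[OF d(1)] unfolding leads_def by auto
  ultimately have "[:- a, 1:] ^ d * [:- a, 1:] dvd [:- a, 1:] ^ d * Polynomial.smult (c d) g" by (simp add: mult.commute)
  then have "[:- a, 1:] dvd Polynomial.smult (c d) g" by (subst (asm) dvd_mult_cancel_left) auto
  then have "c d * v d = 0" using \<open>poly g a = v d\<close> by (simp add: poly_eq_0_iff_dvd[symmetric])
  then show False using d assms(2)[OF d(1)] by simp
qed

text \<open>Elements of distinct orders are independent, while \<open>n + 1\<close> elements of a
  span of \<open>n\<close> polynomials are dependent.\<close>

lemma card_leads_le:
  fixes p :: "nat \<Rightarrow> 'a::field poly" and a :: 'a
  assumes fin: "finite E"
    and ex: "\<And>e. e \<in> E \<Longrightarrow> \<exists>c v. v \<noteq> 0 \<and> leads a e v (\<Sum>j<n. Polynomial.smult (c j) (p j))"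
  shows "card E \<le> n"
proof (rule ccontr)
  assume "\<not> card E \<le> n"
  then obtain E' where E': "E' \<subseteq> E" "card E' = Suc n" "finite E'"
    using fin by (metis not_less_eq_eq obtain_subset_with_card_n)
  obtain b where b: "bij_betw b {..<Suc n} E'"
    using E' by (metis atLeast0LessThan ex_bij_betw_nat_finite)
  obtain c v where cv: "\<And>e. e \<in> E \<Longrightarrow> v e \<noteq> 0 \<and> leads a e (v e) (\<Sum>j<n. Polynomial.smult (c e j) (p j))"
    using ex by metis
  \<comment> \<open>A zero row makes the coefficient matrix square and singular; its kernel vector
    is the linear dependence.\<close>
  have "det (mat (Suc n) (Suc n) (\<lambda>(i, j). if i < n then c (b j) i else 0)) = 0"
    by (subst laplace_expansion_row[of _ "Suc n" n]) auto
  then obtain w where w: "\<exists>j<Suc n. w j \<noteq> 0"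
      "\<And>i. i < Suc n \<Longrightarrow> (\<Sum>j<Suc n. (if i < n then c (b j) i else 0) * w j) = 0"
    by (rule det_mat_eq_0_kernel) blast
  define w' where "w' e = w (inv_into {..<Suc n} b e)" for e
  have w': "w' (b j) = w j" if "j < Suc n" for j
    using b that unfolding w'_def bij_betw_def by (simp add: inv_into_f_f)
  have "(\<Sum>e\<in>E'. Polynomial.smult (w' e) (\<Sum>j<n. Polynomial.smult (c e j) (p j))) =
      (\<Sum>i<Suc n. Polynomial.smult (w i) (\<Sum>j<n. Polynomial.smult (c (b i) j) (p j)))"
    unfolding sum.reindex_bij_betw[OF b, symmetric] by (intro sum.cong refl) (simp add: w')
  also have "\<dots> = (\<Sum>j<n. Polynomial.smult (\<Sum>i<Suc n. c (b i) j * w i) (p j))"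
    by (simp only: smult_sum2 smult_smult smult_sum) (subst sum.swap, simp only: mult.commute)
  also have "\<dots> = 0"
  proof (intro sum.neutral ballI)
    fix j assume "j \<in> {..<n}"
    then show "Polynomial.smult (\<Sum>i<Suc n. c (b i) j * w i) (p j) = 0"
      using w(2)[of j] by simp
  qed
  finally have "w' e = 0" if "e \<in> E'" for e
    by (rule leads_sum_distinct[where a = a and v = v, OF E'(3) _ _ that, rotated]) (use cv E'(1) in auto)
  moreover from w(1) obtain j where "j < Suc n" "w j \<noteq> 0" by blast
  moreover have "b j \<in> E'" using b \<open>j < Suc n\<close> by (auto dest: bij_betwE)
  ultimately show False using w' by metis
qed

section \<open>Invariant operators for \<open>m = 2\<close> and jump 4\<close>

lemma leads_euler_hermite:
  fixes a :: "'a::idom"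
  assumes "leads a (e + 2) v f"
  shows "leads a e (2 * of_nat ((e + 2) * (e + 1)) * v)
    ([:0, 1:] * pderiv f + Polynomial.smult 2 (pderiv (pderiv f)))"
proof -
  have f: "leads a (Suc (Suc e)) v f" using assms by simp
  have "leads a e 0 (pderiv f)" by (rule leads_Suc[OF leads_pderiv[OF f]])
  from leads_add[OF leads_mult[OF this, of "[:0, 1:]"] leads_smult[OF leads_pderiv[OF leads_pderiv[OF f]], of 2]]
  show ?thesis by (simp add: algebra_simps)
qed

text \<open>Only the third derivative contributes at order \<open>e\<close>, and its coefficient 4z
  equals 4a at the point: over the complex numbers the order drops by exactly 3 because
  \<open>a\<close> is nonzero.\<close>

lemma leads_third_order:
  fixes a :: "'a::idom"
  assumes "leads a (e + 3) v f"
  shows "leads a e (4 * a * of_nat ((e + 3) * (e + 2) * (e + 1)) * v)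
    ([:0, 4:] * pderiv (pderiv (pderiv f)) + [:4, 0, 1:] * pderiv (pderiv f) + [:0, 1:] * pderiv f)"
proof -
  have f: "leads a (Suc (Suc (Suc e))) v f" using assms by (simp add: numeral_3_eq_3)
  note d1 = leads_pderiv[OF f] note d2 = leads_pderiv[OF d1] note d3 = leads_pderiv[OF d2]
  have "leads a e 0 (pderiv f)" by (rule leads_Suc[OF leads_Suc[OF d1]])
  moreover have "leads a e 0 (pderiv (pderiv f))" by (rule leads_Suc[OF d2])
  ultimately show ?thesis
    using leads_add[OF leads_add[OF leads_mult[OF d3, of "[:0, 4:]"] leads_mult[of a e 0 "pderiv (pderiv f)" "[:4, 0, 1:]"]]
        leads_mult[of a e 0 "pderiv f" "[:0, 1:]"]]
    by (simp add: algebra_simps)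
qed

lemma euler_hermite_square_minus:
  fixes f :: "'a::idom poly"
  defines "L \<equiv> \<lambda>g. [:0, 1:] * pderiv g + Polynomial.smult 2 (pderiv (pderiv g))"
  shows "L (L f) - Polynomial.smult 4 ((pderiv ^^ 4) f) =
    [:0, 4:] * pderiv (pderiv (pderiv f)) + [:4, 0, 1:] * pderiv (pderiv f) + [:0, 1:] * pderiv f"
proof -
  have X: "[:0, 4:] = 4 * [:0, 1::'a:]" "[:4, 0, 1:] = 4 + [:0, 1::'a:] * [:0, 1:]"
    by (simp_all add: numeral_poly)
  have s: "Polynomial.smult 2 q = 2 * q" "Polynomial.smult 4 q = 4 * q" for q :: "'a poly"
    by (simp_all add: numeral_poly)
  define X where "X = [:0, 1::'a:]"
  have d: "pderiv X = 1" by (simp add: X_def pderiv_pCons)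
  have n: "pderiv (2 * q) = 2 * pderiv q" for q :: "'a poly"
    by (simp flip: s add: pderiv_smult)
  have p4: "(pderiv ^^ 4) f = pderiv (pderiv (pderiv (pderiv f)))"
    by (simp add: eval_nat_numeral)
  show ?thesis unfolding L_def X s p4 unfolding X_def[symmetric]
    by (simp only: pderiv_add pderiv_mult d n)
      (simp add: algebra_simps)
qed

text \<open>Every integer from 2 on is a sum of 2s and 3s, so only the number just below an element
  can be missing.\<close>

lemma nat_closed_under_minus_2_3:
  fixes S :: "nat set"
  assumes "\<And>e. e + 2 \<in> S \<Longrightarrow> e \<in> S" "\<And>e. e + 3 \<in> S \<Longrightarrow> e \<in> S"
  shows "x \<in> S \<Longrightarrow> y + 2 \<le> x \<Longrightarrow> y \<in> S"
proof (induction x rule: less_induct)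
  case (less x)
  consider "x = y + 2" | "x = y + 3" | "y + 4 \<le> x" using less.prems by linarith
  then show ?case
  proof cases
    case 1
    then show ?thesis using assms(1)[of y] less.prems(1) by simp
  next
    case 2
    then show ?thesis using assms(2)[of y] less.prems(1) by simp
  next
    case 3
    then have "x - 2 + 2 = x" by simp
    then have "x - 2 \<in> S" using assms(1) less.prems by metis
    then show ?thesis using less.IH[of "x - 2"] 3 by simp
  qed
qed

text \<open>The degrees \<open>n j\<close> are distinct, so the coefficient at the largest surviving
  index isolates one term.\<close>

lemma smult_combination_pgen_eq_0:
  fixes n :: "nat \<Rightarrow> nat"
  assumes "m \<ge> 1" "strict_mono n" "(\<Sum>j<N. Polynomial.smult (c j) (pgen m (n j))) = 0" "j < N"
  shows "c j = 0"
proof (rule ccontr)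
  assume "c j \<noteq> 0"
  define t where "t = Max {j. j < N \<and> c j \<noteq> 0}"
  have t: "t < N" "c t \<noteq> 0" "\<And>i. i < N \<Longrightarrow> t < i \<Longrightarrow> c i = 0"
    using Max_in[of "{j. j < N \<and> c j \<noteq> 0}"] Max_ge[of "{j. j < N \<and> c j \<noteq> 0}"] assms(4) \<open>c j \<noteq> 0\<close>
    unfolding t_def[symmetric] by (auto simp: not_less[symmetric])
  have "c i * coeff (pgen m (n i)) (n t) = (if i = t then c t / fact (n t) else 0)" if "i < N" for i
    using t(3)[of i] that strict_mono_less[OF assms(2), of i t]
    by (cases i t rule: linorder_cases) (auto simp: coeff_pgen[OF assms(1)])
  then have "(\<Sum>i<N. c i * coeff (pgen m (n i)) (n t)) = (\<Sum>i<N. if i = t then c t / fact (n t) else 0)"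
    by (intro sum.cong) auto
  then have "coeff (\<Sum>j<N. Polynomial.smult (c j) (pgen m (n j))) (n t) = c t / fact (n t)"
    using t(1) by (simp add: coeff_sum)
  then show False using t(2) assms(3) by simp
qed

lemma wronskian_double_root_jump_4:
  fixes a :: complex
  assumes "l < 4" "a \<noteq> 0" "length fs = N" "N \<ge> 1" "\<And>j. j < N \<Longrightarrow> fs ! j = pgen 2 (l + 4 * j)"
    and W: "poly (wronskian fs) a = 0" "poly (pderiv (wronskian fs)) a = 0"
  shows False
proof -
  define P where "P j = pgen 2 (l + 4 * j)" for j
  define F where "F c = (\<Sum>j<N. Polynomial.smult (c j) (P j))" for c
  define S where "S = {e. \<exists>c v. v \<noteq> 0 \<and> leads a e v (F c)}"
  define L :: "complex poly \<Rightarrow> complex poly"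
    where "L = (\<lambda>g. [:0, 1:] * pderiv g + Polynomial.smult 2 (pderiv (pderiv g)))"
  have Lx: "[:0, 1:] * pderiv g + Polynomial.smult 2 (pderiv (pderiv g)) = L g" for g
    by (simp only: L_def)
  have pd: "(pderiv ^^ i) (F c) = (\<Sum>j<N. Polynomial.smult (c j) ((pderiv ^^ i) (P j)))" for i c
    by (induction i) (simp_all add: F_def pderiv_sum pderiv_smult)
  have L: "L (F c) = F (\<lambda>j. of_nat (l + 4 * j) * c j)" for c
  proof -
    have "L (F c) = (\<Sum>j<N. Polynomial.smult (c j) (L (P j)))"
      using pd[of 1 c] pd[of 2 c] unfolding L_def
      by (simp add: numeral_2_eq_2 sum_distrib_left smult_sum2 sum.distrib smult_add_right mult.commute)
    then show ?thesis unfolding F_def L_def P_def pgen_euler_hermite by (simp add: mult.commute)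
  qed
  \<comment> \<open>Four derivatives lower the index by 4, which is a left shift of the coordinates
    \<open>c\<close>; the lowest polynomial is killed because \<open>l < 4\<close>.\<close>
  have D4: "(pderiv ^^ 4) (F c) = F (\<lambda>j. if Suc j < N then c (Suc j) else 0)" for c
  proof -
    obtain N' where N': "N = Suc N'" using assms(4) by (cases N) auto
    have "(pderiv ^^ 4) (P (Suc j)) = P j" "(pderiv ^^ 4) (P 0) = 0" for j
      using assms(1) unfolding P_def by (simp_all add: pderiv_funpow_pgen)
    then have "(\<Sum>j<N. Polynomial.smult (c j) ((pderiv ^^ 4) (P j))) = F (\<lambda>j. if Suc j < N then c (Suc j) else 0)"
      unfolding F_def N' by (subst sum.lessThan_Suc_shift) simp
    then show ?thesis unfolding pd .
  qed
  have K: "F (\<lambda>j. of_nat (l + 4 * j) * (of_nat (l + 4 * j) * c j) - 4 * (if Suc j < N then c (Suc j) else 0)) =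
      L (L (F c)) - Polynomial.smult 4 ((pderiv ^^ 4) (F c))" for c
    unfolding L D4 by (simp only: F_def smult_sum2 smult_smult smult_diff_left sum_subtractf)
  have S2: "e \<in> S" if "e + 2 \<in> S" for e
  proof -
    obtain c v where cv: "v \<noteq> 0" "leads a (e + 2) v (F c)" using \<open>e + 2 \<in> S\<close> unfolding S_def by auto
    have "leads a e (2 * of_nat ((e + 2) * (e + 1)) * v) (F (\<lambda>j. of_nat (l + 4 * j) * c j))"
      using leads_euler_hermite[OF cv(2)] unfolding Lx L .
    moreover have "2 * of_nat ((e + 2) * (e + 1)) * v \<noteq> 0" using cv(1) unfolding mult_eq_0_iff of_nat_eq_0_iff by simp
    ultimately show ?thesis unfolding S_def by blast
  qed
  have S3: "e \<in> S" if "e + 3 \<in> S" for e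
  proof -
    obtain c v where cv: "v \<noteq> 0" "leads a (e + 3) v (F c)" using \<open>e + 3 \<in> S\<close> unfolding S_def by auto
    note leads_third_order[OF cv(2), folded euler_hermite_square_minus[of "F c"], unfolded Lx, folded K]
    moreover have "4 * a * of_nat ((e + 3) * (e + 2) * (e + 1)) * v \<noteq> 0"
      using cv(1) \<open>a \<noteq> 0\<close> unfolding mult_eq_0_iff of_nat_eq_0_iff by simp
    ultimately show ?thesis unfolding S_def by blast
  qed
  have closed: "y \<in> S" if "x \<in> S" "y + 2 \<le> x" for x y
    using nat_closed_under_minus_2_3[of S x y] S2 S3 that by blast
  have card: "card E \<le> N" if "finite E" "E \<subseteq> S" for E
    using card_leads_le[where E = E and a = a and n = N and p = P] that unfolding S_def F_def by auto
  \<comment> \<open>Along with \<open>e\<close>, everything up to \<open>e - 2\<close> lies in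
    \<open>S\<close>, which is already at least \<open>e\<close> orders.\<close>
  have bound: "e \<le> N" if "e \<in> S" for e
  proof -
    have "card (insert e {..<e - 1}) \<le> N"
      using that closed[of e] by (intro card) auto
    then show ?thesis by simp
  qed
  \<comment> \<open>The vanishing determinant yields a nonzero element of the span whose derivatives
    of orders \<open>r i\<close> vanish at \<open>a\<close>; its own order therefore differs from
    every \<open>r i\<close>.\<close>
  have kernel: "\<exists>e\<in>S. \<forall>i<N. r i \<noteq> e" 
    if det0: "det (mat N N (\<lambda>(i, j). poly ((pderiv ^^ r i) (fs ! j)) a)) = 0" for r
  proof -
    obtain c where c: "\<exists>j<N. c j \<noteq> 0" "\<And>i. i < N \<Longrightarrow> (\<Sum>j<N. poly ((pderiv ^^ r i) (fs ! j)) a * c j) = 0"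
      using det_mat_eq_0_kernel[OF det0] by blast
    have zero: "poly ((pderiv ^^ r i) (F c)) a = 0" if "i < N" for i
      using c(2)[OF that] unfolding pd poly_sum by (simp add: P_def assms(5) mult.commute)
    have "F c \<noteq> 0"
      using c(1) smult_combination_pgen_eq_0[where m = 2 and n = "\<lambda>j. l + 4 * j" and N = N and c = c]
      unfolding F_def P_def by (auto simp: strict_mono_def)
    then obtain e v where ev: "v \<noteq> 0" "leads a e v (F c)" by (rule leads_exists)
    have "r i \<noteq> e" if "i < N" for i
      using zero[OF that] leads_poly_funpow_pderiv[OF ev(2,1)] by auto
    moreover have "e \<in> S" using ev unfolding S_def by blast
    ultimately show ?thesis by blast
  qed
  obtain n where n: "N = Suc n" using assms(4) by (cases N) auto
  \<comment> \<open>The rows 0..N-1 of the Wronskian leave only the order N; the rows 0..N-2 and N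
    of its derivative leave only N - 1.\<close>
  have "\<exists>e\<in>S. \<forall>i<N. id i \<noteq> e"
    by (rule kernel) (use W(1) in \<open>simp add: wronskian_def assms(3) poly_det_mat\<close>)
  then obtain e where "e \<in> S" "e \<ge> N" by (force simp: not_less[symmetric])
  then have N: "N \<in> S" using bound[of e] by simp
  have "\<exists>e\<in>S. \<forall>i<N. (if i = n then Suc n else i) \<noteq> e"
    by (rule kernel) (use W(2) assms(3) n in \<open>simp add: pderiv_wronskian poly_det_mat\<close>)
  then obtain e where e: "e \<in> S" "\<And>i. i < N \<Longrightarrow> (if i = n then Suc n else i) \<noteq> e" by blast
  have "e = n" using e(2)[of n] e(2)[of e] bound[OF e(1)] n by (auto split: if_splits)
  have "x \<in> S" if xn: "x \<le> Suc n" for x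
  proof -
    consider "x = Suc n" | "x = n" | "x + 2 \<le> N" using xn n by linarith
    then show ?thesis using N e(1) \<open>e = n\<close> closed[OF N] n by cases auto
  qed
  then have "card {..Suc n} \<le> N" by (intro card) auto
  then show False using n by simp
qed

subsection \<open>Multipliers preserving real-rootedness\<close>

text \<open>Exactly the \<open>d - Suc i\<close> factors with index above \<open>i\<close> are
  negative.\<close>

lemma prod_diff_sign_pos:
  fixes \<rho> :: "nat \<Rightarrow> 'a::linordered_idom"
  assumes "strict_mono_on {..<d} \<rho>" "i < d"
  shows "(-1) ^ (d - Suc i) * (\<Prod>j\<in>{..<d} - {i}. \<rho> i - \<rho> j) > 0"
proof -
  have s: "{..<d} - {i} = {..<i} \<union> {i<..<d}" using assms(2) by auto
  have "(\<Prod>j\<in>{..<d} - {i}. \<rho> i - \<rho> j) = (\<Prod>j<i. \<rho> i - \<rho> j) * (\<Prod>j\<in>{i<..<d}. (-1) * (\<rho> j - \<rho> i))"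
    unfolding s by (subst prod.union_disjoint) auto
  also have "(\<Prod>j\<in>{i<..<d}. (-1) * (\<rho> j - \<rho> i)) = (-1) ^ (d - Suc i) * (\<Prod>j\<in>{i<..<d}. \<rho> j - \<rho> i)"
    unfolding prod.distrib by simp
  finally have "(-1) ^ (d - Suc i) * (\<Prod>j\<in>{..<d} - {i}. \<rho> i - \<rho> j) =
      ((-1) ^ (d - Suc i) * (-1) ^ (d - Suc i)) * ((\<Prod>j<i. \<rho> i - \<rho> j) * (\<Prod>j\<in>{i<..<d}. \<rho> j - \<rho> i))"
    by (simp add: mult_ac)
  also have "\<dots> = (\<Prod>j<i. \<rho> i - \<rho> j) * (\<Prod>j\<in>{i<..<d}. \<rho> j - \<rho> i)"
    by (simp flip: power_mult_distrib)
  also have "\<dots> > 0"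
    using assms by (intro mult_pos_pos prod_pos) (auto simp: strict_mono_on_def)
  finally show ?thesis .
qed

lemma poly_pderiv_prod_linear:
  fixes \<rho> :: "'b \<Rightarrow> 'a::idom"
  assumes "finite I" "i \<in> I"
  shows "poly (pderiv (\<Prod>j\<in>I. [:- \<rho> j, 1:])) (\<rho> i) = (\<Prod>j\<in>I - {i}. \<rho> i - \<rho> j)"
proof -
  have eq: "(\<Prod>j\<in>I. [:- \<rho> j, 1:]) = [:- \<rho> i, 1:] * (\<Prod>j\<in>I - {i}. [:- \<rho> j, 1:])"
    by (rule prod.remove[OF assms])
  show ?thesis unfolding eq pderiv_mult poly_add poly_mult by (simp add: pderiv_pCons poly_prod)
qed

lemma no_double_root_prod_linear:
  fixes \<rho> :: "'b \<Rightarrow> 'a::idom"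
  assumes "finite I" "inj_on \<rho> I" "poly (\<Prod>j\<in>I. [:- \<rho> j, 1:]) x = 0"
  shows "poly (pderiv (\<Prod>j\<in>I. [:- \<rho> j, 1:])) x \<noteq> 0"
proof -
  obtain i where i: "i \<in> I" "x = \<rho> i" using assms(1,3) by (auto simp: poly_prod)
  show ?thesis
    unfolding i(2) poly_pderiv_prod_linear[OF assms(1) i(1)]
    using assms i(1) by (auto simp: inj_on_def)
qed

lemma degree_prod_linear: "degree (\<Prod>i\<in>I. [:- \<rho> i, 1:] :: 'a::idom poly) = card I"
  by (subst degree_prod_eq_sum_degree) auto

lemma eq_prod_linear_of_roots:
  fixes P :: "'a::idom poly"
  assumes "degree P \<le> d" "inj_on \<rho> {..<d}" "\<And>i. i < d \<Longrightarrow> poly P (\<rho> i) = 0"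
  shows "P = Polynomial.smult (coeff P d) (\<Prod>i<d. [:- \<rho> i, 1:])"
proof (rule ccontr)
  let ?Q = "P - Polynomial.smult (coeff P d) (\<Prod>i<d. [:- \<rho> i, 1:])"
  assume "P \<noteq> Polynomial.smult (coeff P d) (\<Prod>i<d. [:- \<rho> i, 1:])"
  then have Q: "?Q \<noteq> 0" by simp
  have "lead_coeff (\<Prod>i<d. [:- \<rho> i, 1:]) = 1" by (simp add: lead_coeff_prod)
  then have "coeff (\<Prod>i<d. [:- \<rho> i, 1:]) d = 1" by (simp add: degree_prod_linear)
  then have "coeff ?Q d = 0" by simp
  moreover have "degree ?Q \<le> d" using assms(1)
    by (intro degree_diff_le) (auto intro: order.trans[OF degree_smult_le] simp: degree_prod_linear)
  ultimately have "degree ?Q < d" using Q by (metis leading_coeff_0_iff le_neq_implies_less)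
  have "\<rho> ` {..<d} \<subseteq> {x. poly ?Q x = 0}" using assms(3) by (auto simp: poly_prod)
  then have "card (\<rho> ` {..<d}) \<le> card {x. poly ?Q x = 0}" by (intro card_mono poly_roots_finite Q)
  also have "\<dots> \<le> degree ?Q" by (rule card_poly_roots_bound[OF Q])
  finally show False using \<open>degree ?Q < d\<close> assms(2) by (simp add: card_image)
qed

text \<open>Consecutive points of opposite sign enclose a root, and \<open>d\<close> roots exhaust
  the degree. The lower bounds \<open>x i\<close> are exported because a first point 0 makes all
  roots positive.\<close>

lemma roots_of_alternating:
  fixes P :: "real poly"
  assumes "degree P \<le> d" "\<And>i. i < d \<Longrightarrow> x i < x (Suc i)"
    and s: "\<And>i. i \<le> d \<Longrightarrow> (-1) ^ (d - i) * poly P (x i) > 0"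
  obtains \<rho> where "strict_mono_on {..<d} \<rho>" "\<And>i. i < d \<Longrightarrow> x i < \<rho> i"
    "P = Polynomial.smult (coeff P d) (\<Prod>i<d. [:- \<rho> i, 1:])"
proof -
  have "\<exists>r. x i < r \<and> r < x (Suc i) \<and> poly P r = 0" if "i < d" for i
  proof -
    have "d - i = Suc (d - Suc i)" using that by simp
    then have "(-1) ^ (d - i) = - ((-1::real) ^ (d - Suc i))" by simp
    then have "poly P (x i) * poly P (x (Suc i)) < 0"
      using s[of i] s[of "Suc i"] that
      by (cases "even (d - Suc i)") (auto simp: mult_less_0_iff)
    then show ?thesis using poly_IVT[OF assms(2)[OF that]] by blast
  qed
  then obtain \<rho> where \<rho>: "\<And>i. i < d \<Longrightarrow> x i < \<rho> i \<and> \<rho> i < x (Suc i) \<and> poly P (\<rho> i) = 0"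
    by metis
  have x: "x i \<le> x j" if "i \<le> j" "j \<le> d" for i j
    using that
  proof (induction j rule: dec_induct)
    case (step j)
    then show ?case using assms(2)[of j] by simp
  qed simp
  have mono: "strict_mono_on {..<d} \<rho>"
  proof (rule strict_mono_onI)
    fix i j assume "i \<in> {..<d}" "j \<in> {..<d}" "i < j"
    then show "\<rho> i < \<rho> j" using \<rho>[of i] \<rho>[of j] x[of "Suc i" j] by simp
  qed
  show ?thesis
    using that[OF mono] \<rho> eq_prod_linear_of_roots[OF assms(1) strict_mono_on_imp_inj_on[OF mono]] by blast
qed

text \<open>Induction on the roots for all \<open>b\<close> at once: a new factor x - c shifts the
  index, and splitting off the first factor of the product turns \<open>b\<close> into
  \<open>b + m\<close>. The entries of \<open>cs\<close> may coincide, the resulting roots do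
  not.\<close>

lemma multiplier_real_rooted:
  fixes m b :: real
  assumes "m > 0" "b > 0" "\<And>c. c \<in> set cs \<Longrightarrow> c > 0"
    and "\<And>i. coeff R i = coeff (\<Prod>c\<leftarrow>cs. [:- c, 1:]) i / (\<Prod>t<i. b + m * real t)"
  shows "\<exists>\<rho>. strict_mono_on {..<length cs} \<rho> \<and> (\<forall>i<length cs. \<rho> i > 0) \<and> coeff R (length cs) > 0 \<and>
    R = Polynomial.smult (coeff R (length cs)) (\<Prod>i<length cs. [:- \<rho> i, 1:])"
  using assms(2-)
proof (induction cs arbitrary: b R)
  case Nil
  have "R = [:1:]" by (rule poly_eqI) (use Nil.prems(3) in \<open>auto simp: coeff_pCons split: nat.splits\<close>)
  then show ?case by (auto intro!: exI[of _ id] simp: strict_mono_on_def)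
next
  case (Cons c cs)
  define P where "P = (\<Prod>c\<leftarrow>cs. [:- c, 1:])"
  define d where "d = length cs"
  define pp where "pp b i = (\<Prod>t<i. b + m * real t)" for b i
  define R' where "R' = (\<Sum>i\<le>degree P. monom (coeff P i / pp (b + m) i) i)"
  have pp_pos: "pp b i > 0" if "b > 0" for b i
    unfolding pp_def using that \<open>m > 0\<close> by (intro prod_pos) (simp add: add_pos_nonneg)
  have b: "b > 0" "b + m > 0" using Cons.prems \<open>m > 0\<close> by auto
  have pp_Suc: "pp b (Suc i) = b * pp (b + m) i" for i
    unfolding pp_def prod.lessThan_Suc_shift by (simp add: algebra_simps)
  have pp_shift: "pp b i * (b + m * real i) = b * pp (b + m) i" for i
    using pp_Suc[of i] by (simp add: pp_def)
  have cR': "coeff R' i = coeff P i / pp (b + m) i" for i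
    by (auto simp: R'_def coeff_sum coeff_eq_0 not_le)
  from Cons.IH[OF b(2), of R'] cR' Cons.prems(2) obtain \<rho> where \<rho>: "strict_mono_on {..<d} \<rho>"
      "\<And>i. i < d \<Longrightarrow> \<rho> i > 0" "coeff R' d > 0" 
      "R' = Polynomial.smult (coeff R' d) (\<Prod>i<d. [:- \<rho> i, 1:])"
    unfolding P_def d_def pp_def by auto
  \<comment> \<open>Multiplication by x corresponds to \<open>pp_Suc\<close> and the operator b + m
    x D to \<open>pp_shift\<close>; both lead from the parameter \<open>b + m\<close> back to
    \<open>b\<close>.\<close>
  have R: "R = Polynomial.smult (1 / b) ([:0, 1:] * R' - Polynomial.smult c (Polynomial.smult b R' + Polynomial.smult m ([:0, 1:] * pderiv R')))"
  proof (rule poly_eqI)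
    fix i
    have c: "coeff R i = ((case i of 0 \<Rightarrow> 0 | Suc j \<Rightarrow> coeff P j) - c * coeff P i) / pp b i"
      using Cons.prems(3)[of i] by (simp add: P_def pp_def coeff_pCons split: nat.splits)
    have z: "coeff ([:0, 1:] * pderiv R') i = real i * coeff R' i"
      by (cases i) (auto simp: coeff_pderiv)
    have e: "coeff P i / pp b i = (1 / b) * ((b + m * real i) * coeff R' i)"
    proof -
      have "b + m * real i > 0" using b(1) \<open>m > 0\<close> by (simp add: add_pos_nonneg)
      moreover have "pp (b + m) i = pp b i * (b + m * real i) / b"
        using pp_shift[of i] b by (simp add: field_simps)
      moreover note pp_pos[OF b(2), of i]
      ultimately show ?thesis unfolding cR' using pp_pos[OF b(1), of i] b
        by (simp add: divide_simps mult.commute)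
    qed
    have f: "(case i of 0 \<Rightarrow> 0 | Suc j \<Rightarrow> coeff P j) / pp b i = (1 / b) * coeff ([:0, 1:] * R') i"
      by (cases i) (simp_all add: cR' pp_Suc)
    show "coeff R i = coeff (Polynomial.smult (1 / b) ([:0, 1:] * R' - Polynomial.smult c (Polynomial.smult b R' + Polynomial.smult m ([:0, 1:] * pderiv R')))) i"
      unfolding c coeff_smult coeff_diff coeff_add z diff_divide_distrib f times_divide_eq_right[symmetric] e
      by (simp add: algebra_simps)
  qed
  have degR': "degree R' = d" using \<rho>(3) by (subst \<rho>(4)) (simp add: degree_prod_linear)
  have "coeff R (Suc d) = coeff R' d / b"
    unfolding R using degR' by (simp add: coeff_eq_0 coeff_pderiv)
  then have lc: "coeff R (Suc d) > 0" using \<rho>(3) b by simp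
  have "degree ([:0, 1:] * R') \<le> Suc d" "degree ([:0, 1:] * pderiv R') \<le> Suc d" "degree R' \<le> Suc d"
    using degR' by (auto intro!: order.trans[OF degree_mult_le] simp: degree_pderiv)
  then have "degree R \<le> Suc d" unfolding R
    by (intro order.trans[OF degree_smult_le] degree_diff_le degree_add_le) auto
  then have degR: "degree R = Suc d" using lc by (metis le_antisym le_degree less_irrefl)
  obtain B where B: "\<And>x. x \<ge> B \<Longrightarrow> poly R x > 0"
    using poly_pinfty_gt_lc[of R] lc degR by (metis less_le_trans)
  \<comment> \<open>Signs are read at 0, at the roots of \<open>R'\<close> and far to the right:
    \<open>d + 2\<close> points for degree \<open>d + 1\<close>. At a root of \<open>R'\<close> only
    the term with \<open>pderiv R'\<close> survives.\<close>
  define x where "x i = (if i = 0 then 0 else if i \<le> d then \<rho> (i - 1) else max B (if d = 0 then 1 else \<rho> (d - 1) + 1))" for i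
  have xs: "x i < x (Suc i)" if "i < Suc d" for i
    using that \<rho>(2)[of 0] \<rho>(2)[of "d - 1"] strict_mono_onD[OF \<rho>(1), of "i - 1" i]
    unfolding x_def by (cases i; cases "i = d") (auto simp: less_max_iff_disj)
  have sgn: "(-1) ^ (Suc d - i) * poly R (x i) > 0" if i: "i \<le> Suc d" for i
  proof (cases "i = 0 \<or> i = Suc d")
    case False
    then obtain j where j: "i = Suc j" "j < d" using i by (cases i) auto
    have "poly R' (\<rho> j) = 0" using j by (subst \<rho>(4)) (auto simp: poly_prod)
    then have "poly R (\<rho> j) = - (c * m * \<rho> j / b) * poly (pderiv R') (\<rho> j)"
      unfolding R by simp
    also have "poly (pderiv R') (\<rho> j) = coeff R' d * (\<Prod>i\<in>{..<d} - {j}. \<rho> j - \<rho> i)"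
      using j by (subst \<rho>(4)) (simp add: pderiv_smult poly_pderiv_prod_linear)
    finally have "(-1) ^ (d - j) * poly R (\<rho> j) =
        (c * m * \<rho> j / b * coeff R' d) * ((-1) ^ (d - Suc j) * (\<Prod>i\<in>{..<d} - {j}. \<rho> j - \<rho> i))"
      using j(2) by (simp add: Suc_diff_Suc[symmetric] del: Suc_diff_Suc)
    also have "\<dots> > 0"
      using Cons.prems(2)[of c] \<open>m > 0\<close> b \<rho>(2)[OF j(2)] \<rho>(3)
      by (intro mult_pos_pos[OF _ prod_diff_sign_pos[OF \<rho>(1) j(2)]]) simp
    finally show ?thesis using j by (simp add: x_def)
  next
    case True
    have "poly R' 0 = coeff R' d * ((-1) ^ d * (\<Prod>i<d. \<rho> i))"
      by (subst \<rho>(4)) (simp add: poly_prod prod_uminus)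
    moreover have "(\<Prod>i<d. \<rho> i) > 0" using \<rho>(2) by (intro prod_pos) auto
    moreover have "poly R 0 = - c * poly R' 0" using b unfolding R by simp
    ultimately have "(-1) ^ Suc d * poly R 0 = (c * coeff R' d * (\<Prod>i<d. \<rho> i)) * ((-1) ^ d * (-1) ^ d)"
      by (simp add: mult_ac)
    then have "(-1) ^ Suc d * poly R 0 > 0"
      using Cons.prems(2)[of c] \<rho>(3) \<open>(\<Prod>i<d. \<rho> i) > 0\<close> by (simp flip: power_mult_distrib)
    with True show ?thesis using B by (auto simp: x_def)
  qed
  from roots_of_alternating[of R "Suc d" x, OF _ xs sgn] degR obtain \<rho>' where \<rho>': "strict_mono_on {..<Suc d} \<rho>'"
     "\<And>i. i < Suc d \<Longrightarrow> x i < \<rho>' i" "R = Polynomial.smult (coeff R (Suc d)) (\<Prod>i<Suc d. [:- \<rho>' i, 1:])"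
    by auto
  have "\<rho>' i > 0" if "i < Suc d" for i
    using \<rho>'(2)[OF that] that \<rho>(2)[of "i - 1"] by (cases i) (auto simp: x_def)
  then show ?case using \<rho>' lc unfolding d_def by auto
qed

lemma fact_add_eq_prod: "fact (a + n) = fact a * (\<Prod>s\<in>{a<..a + n}. of_nat s :: 'a::{comm_semiring_1, semiring_char_0})"
proof (induction n)
  case (Suc n)
  have "{a<..a + Suc n} = insert (a + Suc n) {a<..a + n}" by auto
  then show ?case using Suc by (simp add: algebra_simps)
qed simp

text \<open>The numbers r + 1, ..., r + m i are grouped by residue modulo \<open>m\<close>; the
  class of \<open>b\<close> consists of b, b + m, ..., b + m (i - 1).\<close>

lemma fact_add_mult_eq_prod:
  "fact (r + m * i) = fact r * (\<Prod>b\<in>{r<..r + m}. \<Prod>t<i. real b + real m * real t)"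
proof (induction i)
  case (Suc i)
  have "(\<Prod>s\<in>{r + m * i<..r + m * i + m}. real s) = (\<Prod>b\<in>{r<..r + m}. real b + real m * real i)"
    by (rule prod.reindex_bij_witness[of _ "\<lambda>b. b + m * i" "\<lambda>b. b - m * i"]) (auto simp: algebra_simps of_nat_diff)
  then have "(fact (r + m * i + m) :: real) = fact (r + m * i) * (\<Prod>b\<in>{r<..r + m}. real b + real m * real i)"
    using fact_add_eq_prod[of "r + m * i" m, where ?'a = real] by simp
  moreover have "r + m * Suc i = r + m * i + m" by simp
  ultimately show ?case unfolding prod.lessThan_Suc prod.distrib using Suc by (simp only: mult_ac)
qed simp

text \<open>One multiplier per element of \<open>B\<close>. The initial (x - m)^M has an M-fold
  root, so simple roots appear only with the first multiplier, hence the condition that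
  \<open>B\<close> is nonempty.\<close>

lemma multipliers_real_rooted:
  fixes m :: real
  assumes "m > 0" "finite B" "\<And>b. b \<in> B \<Longrightarrow> b > (0::real)"
    and "\<And>i. coeff R i = coeff ([:- m, 1:] ^ M) i / (\<Prod>b\<in>B. \<Prod>t<i. b + m * real t)"
    and "B \<noteq> {}"
  shows "\<exists>\<rho>. strict_mono_on {..<M} \<rho> \<and> (\<forall>i<M. \<rho> i > 0) \<and> coeff R M > 0 \<and>
    R = Polynomial.smult (coeff R M) (\<Prod>i<M. [:- \<rho> i, 1:])"
  using assms(2,5,3,4)
proof (induction B arbitrary: R rule: finite_ne_induct)
  case (singleton b)
  then show ?case
    using multiplier_real_rooted[OF assms(1), of b "replicate M m" R] assms(1) by simp
next
  case (insert b B)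
  have pos: "(\<Prod>b\<in>B. \<Prod>t<i. b + m * real t) > 0" for i
    using insert.prems(1) assms(1) by (intro prod_pos ballI) (auto intro!: add_pos_nonneg)
  define Q where "Q = (\<Sum>i\<le>M. monom (coeff ([:- m, 1:] ^ M) i / (\<Prod>b\<in>B. \<Prod>t<i. b + m * real t)) i)"
  have deg: "degree ([:- m, 1:] ^ M) = M" by (simp add: degree_power_eq)
  have Q: "coeff Q i = coeff ([:- m, 1:] ^ M) i / (\<Prod>b\<in>B. \<Prod>t<i. b + m * real t)" for i
    using deg by (auto simp: Q_def coeff_sum coeff_eq_0)
  obtain \<rho> where \<rho>: "strict_mono_on {..<M} \<rho>" "\<forall>i<M. \<rho> i > 0" "coeff Q M > 0"
      "Q = Polynomial.smult (coeff Q M) (\<Prod>i<M. [:- \<rho> i, 1:])"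
    using insert.IH[of Q] Q insert.prems(1) by auto
  \<comment> \<open>The one-multiplier result starts from a monic product, so the leading
    coefficient of \<open>Q\<close> is divided out.\<close>
  define R' where "R' = Polynomial.smult (inverse (coeff Q M)) R"
  have prodl: "(\<Prod>c\<leftarrow>map \<rho> [0..<M]. [:- c, 1:]) = (\<Prod>i<M. [:- \<rho> i, 1:])"
    by (induction M) (simp_all add: mult.commute)
  have "coeff R' i = coeff (\<Prod>c\<leftarrow>map \<rho> [0..<M]. [:- c, 1:]) i / (\<Prod>t<i. b + m * real t)" for i
  proof -
    have "coeff Q i = coeff Q M * coeff (\<Prod>i<M. [:- \<rho> i, 1:]) i" by (subst \<rho>(4)) simp
    then have "coeff (\<Prod>i<M. [:- \<rho> i, 1:]) i = coeff Q i / coeff Q M" using \<rho>(3) by simp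
    moreover have "coeff R i = coeff Q i / (\<Prod>t<i. b + m * real t)"
      unfolding insert.prems(2) Q using insert.hyps by (simp add: mult.commute)
    ultimately show ?thesis unfolding prodl R'_def coeff_smult by (simp add: divide_inverse)
  qed
  moreover have "c > 0" if "c \<in> set (map \<rho> [0..<M])" for c using that \<rho>(2) by auto
  ultimately have "\<exists>\<rho>. strict_mono_on {..<M} \<rho> \<and> (\<forall>i<M. \<rho> i > 0) \<and> coeff R' M > 0 \<and>
      R' = Polynomial.smult (coeff R' M) (\<Prod>i<M. [:- \<rho> i, 1:])"
    using multiplier_real_rooted[OF assms(1), of b "map \<rho> [0..<M]" R'] insert.prems(1)
    by (simp del: set_map)
  then obtain \<sigma> where \<sigma>: "strict_mono_on {..<M} \<sigma>" "\<forall>i<M. \<sigma> i > 0" "coeff R' M > 0"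
      "R' = Polynomial.smult (coeff R' M) (\<Prod>i<M. [:- \<sigma> i, 1:])" by auto
  have R: "R = Polynomial.smult (coeff Q M) R'" using \<rho>(3) by (simp add: R'_def)
  have "coeff R M > 0" unfolding R using \<rho>(3) \<sigma>(3) by simp
  moreover have "R = Polynomial.smult (coeff R M) (\<Prod>i<M. [:- \<sigma> i, 1:])"
    by (subst R, subst \<sigma>(4)) (simp add: R)
  ultimately show ?case using \<sigma>(1,2) by blast
qed

text \<open>Up to the sign (-1)^M, \<open>F\<close> is p_(r + m M) with z^r removed, z^m replaced by
  x, and x reflected to -x.\<close>

lemma exp_power_coeffs_real_rooted:
  assumes "m \<ge> 2" "r < m"
    and "\<And>i. coeff F i = (if i \<le> M then (-1) ^ (M - i) / (fact (r + m * i) * fact (M - i)) else 0)"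
  shows "\<exists>\<rho>. strict_mono_on {..<M} \<rho> \<and> (\<forall>i<M. \<rho> i > 0) \<and> coeff F M > (0::real) \<and>
    F = Polynomial.smult (coeff F M) (\<Prod>i<M. [:- \<rho> i, 1:])"
proof -
  \<comment> \<open>The multiplier of \<open>b = m\<close> is \<open>m ^ i * fact i\<close>. It is
    kept out of \<open>B\<close> because it provides the \<open>fact i\<close> and the power of
    \<open>m\<close> in the coefficients of (x - m)^M; \<open>K\<close> collects what does not
    depend on \<open>i\<close>.\<close>
  define B where "B = real ` ({r<..r + m} - {m})"
  define K :: real where "K = fact r * fact M * real m ^ M"
  have K: "K > 0" using assms by (simp add: K_def)
  define R where "R = Polynomial.smult K F"
  have "card ({r<..r + m} - {m}) = m - 1" using assms by (subst card_Diff_singleton) auto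
  then have ne: "{r<..r + m} - {m} \<noteq> {}" using assms by (metis card.empty diff_is_0_eq not_less_eq_eq numeral_2_eq_2 One_nat_def)
  have "coeff R i = coeff ([:- real m, 1:] ^ M) i / (\<Prod>b\<in>B. \<Prod>t<i. b + real m * real t)" for i
  proof (cases "i \<le> M")
    case True
    have B: "(\<Prod>b\<in>B. \<Prod>t<i. b + real m * real t) = (\<Prod>b\<in>{r<..r + m} - {m}. \<Prod>t<i. real b + real m * real t)"
      unfolding B_def by (subst prod.reindex) auto
    have m: "(\<Prod>t<i. real m + real m * real t) = real m ^ i * fact i"
      by (induction i) (auto simp: algebra_simps)
    have f: "fact (r + m * i) = fact r * (real m ^ i * fact i * (\<Prod>b\<in>B. \<Prod>t<i. b + real m * real t))"
      unfolding fact_add_mult_eq_prod B m[symmetric] using assms by (subst prod.remove[of _ m]) auto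
    have pos: "(\<Prod>b\<in>B. \<Prod>t<i. b + real m * real t) > 0"
      unfolding B_def using assms by (intro prod_pos ballI) (auto intro!: add_pos_nonneg)
    have c: "coeff ([:- real m, 1:] ^ M) i = of_nat (M choose i) * (- real m) ^ (M - i)"
      using coeff_linear_poly_power[OF True, of "- real m" 1] by simp
    have ch: "real (M choose i) = fact M / (fact i * fact (M - i))"
      using True by (simp add: binomial_fact)
    have "real m ^ M = real m ^ i * real m ^ (M - i)" using True by (simp flip: power_add)
    then show ?thesis unfolding c ch R_def K_def coeff_smult assms(3) f
      using True pos assms by (simp add: divide_simps power_minus[of "real m"])
  next
    case False
    then show ?thesis by (simp add: R_def assms(3) coeff_eq_0 degree_power_eq)
  qed
  from multipliers_real_rooted[OF _ _ _ this] ne assms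
  obtain \<rho> where \<rho>: "strict_mono_on {..<M} \<rho>" "\<forall>i<M. \<rho> i > 0" "coeff R M > 0"
      "R = Polynomial.smult (coeff R M) (\<Prod>i<M. [:- \<rho> i, 1:])"
    unfolding B_def by (force simp del: Diff_eq_empty_iff)
  have "F = Polynomial.smult (inverse K) R" using K by (simp add: R_def)
  moreover from this have "coeff F M = inverse K * coeff R M" by simp
  ultimately have "F = Polynomial.smult (coeff F M) (\<Prod>i<M. [:- \<rho> i, 1:])" "coeff F M > 0"
    using K \<rho>(3) by (metis \<rho>(4) smult_smult, simp)
  then show ?thesis using \<rho> by blast
qed

text \<open>\<open>G\<close> is the reflected form of z p' - l p. At a root of \<open>F\<close> it
  is a positive multiple of the derivative of \<open>F\<close>, so its signs alternate there. The
  additional point lies far to the left, since the least root of \<open>G\<close> may be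
  negative.\<close>

lemma exp_power_wronskian_real_rooted:
  fixes r l m M :: nat
  assumes "m \<ge> 2" "r < m" "l < r + m * M"
    and G: "\<And>i. coeff G i = (if i \<le> M then (-1) ^ (M - i) * (real (r + m * i) - real l) / (fact (r + m * i) * fact (M - i)) else 0)"
  shows "\<exists>\<rho>. strict_mono_on {..<M} \<rho> \<and> coeff G M > (0::real) \<and> G = Polynomial.smult (coeff G M) (\<Prod>i<M. [:- \<rho> i, 1:])"
proof -
  define F where "F = (\<Sum>i\<le>M. monom ((-1) ^ (M - i) / (fact (r + m * i) * fact (M - i)) :: real) i)"
  have cF: "coeff F i = (if i \<le> M then (-1) ^ (M - i) / (fact (r + m * i) * fact (M - i)) else 0)" for i
    by (auto simp: F_def coeff_sum)
  obtain \<rho> where \<rho>: "strict_mono_on {..<M} \<rho>" "\<forall>i<M. \<rho> i > 0" "coeff F M > 0"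
      "F = Polynomial.smult (coeff F M) (\<Prod>i<M. [:- \<rho> i, 1:])"
    using exp_power_coeffs_real_rooted[OF assms(1,2) cF] by blast
  have GF: "G = Polynomial.smult (real r - real l) F + Polynomial.smult (real m) ([:0, 1:] * pderiv F)"
  proof (rule poly_eqI)
    fix i
    have z: "coeff ([:0, 1:] * pderiv F) i = real i * coeff F i"
      by (cases i) (auto simp: coeff_pderiv)
    show "coeff G i = coeff (Polynomial.smult (real r - real l) F + Polynomial.smult (real m) ([:0, 1:] * pderiv F)) i"
      unfolding coeff_add coeff_smult z cF G by (auto simp: divide_simps algebra_simps)
  qed
  have lc: "coeff G M > 0" using assms(3) unfolding G by (simp flip: of_nat_mult of_nat_add)
  have degG: "degree G \<le> M" by (rule degree_le) (simp add: G)
  then have "degree G = M" using lc by (metis le_antisym le_degree less_irrefl)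
  \<comment> \<open>After reflection and multiplication by (-1)^M the leading coefficient is
    positive, so behaviour at plus infinity gives the sign of \<open>G\<close> at
    \<open>- b\<close>.\<close>
  have "lead_coeff (pcompose (Polynomial.smult ((-1) ^ M) G) [:0, -1:]) > 0"
    using lc \<open>degree G = M\<close> by (subst lead_coeff_comp) (auto simp: mult.commute mult.left_commute simp flip: power_mult_distrib)
  then obtain B where B: "\<And>x. x \<ge> B \<Longrightarrow> poly (pcompose (Polynomial.smult ((-1) ^ M) G) [:0, -1:]) x > 0"
    using poly_pinfty_gt_lc by (metis less_le_trans)
  define b where "b = max B 0"
  have b: "(-1) ^ M * poly G (- b) > 0" "b \<ge> 0" using B[of b] by (auto simp: b_def poly_pcompose)
  define x where "x i = (if i = 0 then - b else \<rho> (i - 1))" for i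
  have xs: "x i < x (Suc i)" if "i < M" for i
    using that \<rho>(2)[rule_format, of 0] b(2) strict_mono_onD[OF \<rho>(1), of "i - 1" i]
    unfolding x_def by (cases i) auto
  have sgn: "(-1) ^ (M - i) * poly G (x i) > 0" if i: "i \<le> M" for i
  proof (cases i)
    case 0
    then show ?thesis using b by (simp add: x_def)
  next
    case (Suc j)
    then have j: "j < M" using i by simp
    have "poly F (\<rho> j) = 0" using j by (subst \<rho>(4)) (auto simp: poly_prod)
    then have "poly G (\<rho> j) = real m * \<rho> j * poly (pderiv F) (\<rho> j)" unfolding GF by simp
    also have "poly (pderiv F) (\<rho> j) = coeff F M * (\<Prod>i\<in>{..<M} - {j}. \<rho> j - \<rho> i)"
      using j by (subst \<rho>(4)) (simp add: pderiv_smult poly_pderiv_prod_linear)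
    finally have "(-1) ^ (M - Suc j) * poly G (\<rho> j) =
        (real m * \<rho> j * coeff F M) * ((-1) ^ (M - Suc j) * (\<Prod>i\<in>{..<M} - {j}. \<rho> j - \<rho> i))"
      by (simp add: mult_ac)
    also have "\<dots> > 0"
      using assms(1) \<rho>(2) \<rho>(3) j
      by (intro mult_pos_pos[OF _ prod_diff_sign_pos[OF \<rho>(1) j]]) simp
    finally show ?thesis using Suc by (simp add: x_def)
  qed
  show ?thesis using roots_of_alternating[of G M x, OF degG xs sgn] lc by metis
qed

section \<open>The Wronskian of two polynomials\<close>

lemma wronskian_two: "wronskian [f, g] = f * pderiv g - g * pderiv f"
  unfolding wronskian_def
  by (subst laplace_expansion_row[of _ 2 0]) (auto simp: cofactor_def mat_delete_def numeral_2_eq_2 det_single)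

lemma pgen_eq_monom:
  assumes "l < m"
  shows "pgen m l = monom (1 / fact l) l"
proof (rule poly_eqI)
  fix d
  have "m dvd l - d \<longleftrightarrow> l \<le> d"
    using assms by (metis diff_is_0_eq dvd_0_right dvd_imp_le less_imp_diff_less not_less zero_less_diff)
  then show "coeff (pgen m l) d = coeff (monom (1 / fact l) l) d"
    using assms by (auto simp: coeff_pgen)
qed

lemma pgen_eq_sum_monom:
  assumes "m \<ge> 1" "r < m"
  shows "pgen m (r + m * M) = (\<Sum>i\<le>M. monom (1 / (fact (r + m * i) * fact (M - i))) (r + m * i))"
proof (rule poly_eqI)
  fix d
  show "coeff (pgen m (r + m * M)) d =
    coeff (\<Sum>i\<le>M. monom (1 / (fact (r + m * i) * fact (M - i))) (r + m * i)) d"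
  proof (cases "\<exists>i\<le>M. d = r + m * i")
    case True
    then obtain i where i: "i \<le> M" "d = r + m * i" by auto
    have "r + m * M - d = m * (M - i)" using i by (simp add: diff_mult_distrib2)
    then have "coeff (pgen m (r + m * M)) d = 1 / (fact (r + m * i) * fact (M - i))"
      using assms i by (simp add: coeff_pgen)
    moreover have "(\<Sum>j\<le>M. if r + m * j = d then 1 / (fact (r + m * j) * fact (M - j)) else (0::complex)) =
        (\<Sum>j\<le>M. if j = i then 1 / (fact (r + m * i) * fact (M - i)) else 0)"
      using assms i by (intro sum.cong) auto
    ultimately show ?thesis using i by (simp add: coeff_sum)
  next
    case False
    have "\<not> (d \<le> r + m * M \<and> m dvd r + m * M - d)"
    proof
      assume "d \<le> r + m * M \<and> m dvd r + m * M - d"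
      then obtain j where j: "r + m * M = d + m * j" by (metis dvdE le_add_diff_inverse)
      have "j \<le> M"
      proof (rule ccontr)
        assume "\<not> j \<le> M"
        then have "m * Suc M \<le> m * j" by (intro mult_le_mono) auto
        then show False using j assms by simp
      qed
      then have "d = r + m * (M - j)" using j mult_le_mono2[of j M m] by (simp add: diff_mult_distrib2)
      then show False using False diff_le_self by blast
    qed
    then show ?thesis using False assms by (auto simp: coeff_pgen coeff_sum intro!: sum.neutral)
  qed
qed

lemma wronskian_double_root_two:
  fixes z :: complex
  assumes "m \<ge> 2" "1 \<le> l" "l < m" "l < n" "z \<noteq> 0"
    and W: "poly (wronskian [pgen m l, pgen m n]) z = 0" "poly (pderiv (wronskian [pgen m l, pgen m n])) z = 0"
  shows False
proof -
  define r M where "r = n mod m" and "M = n div m"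
  have n: "n = r + m * M" and r: "r < m" using assms(1) by (simp_all add: r_def M_def)
  define c where "c i = (if i \<le> M then (of_nat (r + m * i) - of_nat l) / (fact (r + m * i) * fact (M - i)) else 0 :: complex)" for i
  define \<chi> where "\<chi> = (\<Sum>i\<le>M. monom (c i) i)"
  have c\<chi>: "coeff \<chi> i = c i" for i by (auto simp: \<chi>_def coeff_sum c_def)
  \<comment> \<open>\<open>monom 1 0\<close> is 1; it only brings the identity into the shape used
    by \<open>double_root_pcompose_monom\<close>.\<close>
  have eq: "wronskian [pgen m l, pgen m n] * monom 1 0 =
      Polynomial.smult (1 / fact l) (monom 1 (l - 1 + r) * pcompose \<chi> (monom 1 m))"
  proof -
    have e: "[:0, 1:] * pderiv (pgen m n) - Polynomial.smult (of_nat l) (pgen m n) = monom 1 r * pcompose \<chi> (monom 1 m)"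
    proof -
      have a: "[:0, 1:] * pderiv (monom b d) = Polynomial.smult (of_nat d) (monom b d)" for b :: complex and d
        by (cases d) (auto simp: pderiv_monom smult_monom simp flip: monom_Suc)
      have p: "pgen m n = (\<Sum>i\<le>M. monom (1 / (fact (r + m * i) * fact (M - i))) (r + m * i))"
        unfolding n using assms(1) r by (intro pgen_eq_sum_monom) auto
      have "[:0, 1:] * pderiv (pgen m n) - Polynomial.smult (of_nat l) (pgen m n) =
          (\<Sum>i\<le>M. Polynomial.smult (of_nat (r + m * i)) (monom (1 / (fact (r + m * i) * fact (M - i))) (r + m * i))
            - Polynomial.smult (of_nat l) (monom (1 / (fact (r + m * i) * fact (M - i))) (r + m * i)))"
        unfolding p pderiv_sum sum_distrib_left a smult_sum2 sum_subtractf ..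
      also have "\<dots> = (\<Sum>i\<le>M. monom (c i) (r + m * i))"
        by (intro sum.cong refl)
          (auto simp: c_def smult_monom diff_monom diff_divide_distrib simp del: of_nat_add of_nat_mult)
      also have "\<dots> = monom 1 r * pcompose \<chi> (monom 1 m)"
        by (auto simp: \<chi>_def pcompose_sum sum_distrib_left monom_altdef pcompose_smult pcompose_hom.hom_power power_add power_mult intro!: sum.cong)
      finally show ?thesis .
    qed
    have l: "monom (1 / fact l) l = Polynomial.smult (1 / fact l) (monom 1 (l - 1) * [:0, 1::complex:])"
      using assms(2) by (cases l) (auto simp: smult_monom monom_Suc)
    have "wronskian [pgen m l, pgen m n] = Polynomial.smult (1 / fact l) (monom 1 (l - 1) * 
        ([:0, 1:] * pderiv (pgen m n) - Polynomial.smult (of_nat l) (pgen m n)))"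
    proof -
      have "pderiv (monom (1 / fact l) l) = Polynomial.smult (1 / fact l) (monom 1 (l - 1) * Polynomial.smult (of_nat l) (1 :: complex poly))"
        by (simp add: pderiv_monom smult_monom)
      then show ?thesis
        unfolding wronskian_two pgen_eq_monom[OF assms(3)] by (subst l) (simp add: algebra_simps smult_diff_right)
    qed
    then show ?thesis unfolding e by (simp add: mult_monom mult.assoc[symmetric])
  qed
  from double_root_pcompose_monom[OF eq _ assms(5) _ W] assms(1)
  have root: "poly \<chi> (z ^ m) = 0" "poly (pderiv \<chi>) (z ^ m) = 0" by auto
  define G where "G = (\<Sum>i\<le>M. monom ((-1) ^ (M - i) * (real (r + m * i) - real l) / (fact (r + m * i) * fact (M - i))) i)"
  have cG: "coeff G i = (if i \<le> M then (-1) ^ (M - i) * (real (r + m * i) - real l) / (fact (r + m * i) * fact (M - i)) else 0)" for i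
    by (auto simp: G_def coeff_sum)
  obtain \<rho> where \<rho>: "strict_mono_on {..<M} \<rho>" "coeff G M > 0" "G = Polynomial.smult (coeff G M) (\<Prod>i<M. [:- \<rho> i, 1:])"
    using exp_power_wronskian_real_rooted[OF assms(1) r _ cG] assms(4) n by blast
  interpret h: map_poly_inj_idom_hom complex_of_real ..
  \<comment> \<open>Reflection produces the alternating signs of \<open>G\<close>, whose roots are
    real and simple.\<close>
  define q where "q = pcompose \<chi> [:0, -1:]"
  have "q = Polynomial.smult ((-1) ^ M) (map_poly of_real G)"
  proof (rule poly_eqI)
    fix i
    have "(-1::complex) ^ M = (-1) ^ i * (-1) ^ (M - i)" if "i \<le> M" using that by (simp flip: power_add)
    then show "coeff q i = coeff (Polynomial.smult ((-1) ^ M) (map_poly of_real G)) i"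
      by (auto simp: q_def coeff_pcompose_linear c\<chi> c_def coeff_map_poly cG mult.assoc simp flip: power_mult_distrib)
  qed
  also have "map_poly of_real G = Polynomial.smult (of_real (coeff G M)) (\<Prod>i<M. [:- complex_of_real (\<rho> i), 1:])"
    by (subst \<rho>(3)) (simp add: of_real_hom.map_poly_hom_smult h.hom_prod)
  finally have q: "q = Polynomial.smult ((-1) ^ M * of_real (coeff G M)) (\<Prod>i<M. [:- complex_of_real (\<rho> i), 1:])" by simp
  have "poly q (- (z ^ m)) = 0" "poly (pderiv q) (- (z ^ m)) = 0"
    using root by (simp_all add: q_def poly_pcompose pderiv_pcompose)
  moreover have "inj_on (\<lambda>i. complex_of_real (\<rho> i)) {..<M}"
    using strict_mono_on_imp_inj_on[OF \<rho>(1)] by (auto simp: inj_on_def)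
  ultimately show False
    using \<rho>(2) no_double_root_prod_linear[of "{..<M}" "\<lambda>i. complex_of_real (\<rho> i)" "- (z ^ m)"]
    unfolding q by (auto simp: pderiv_smult)
qed

subsection \<open>Variation diminishing kernels\<close>

text \<open>In variation diminishing theory this is S^-(x) >= r, the count of sign changes with
  zeros discarded. A lower bound is stated instead of a count, so its witness is a list of
  \<open>r + 1\<close> indices; \<open>\<sigma>\<close> is the first sign.\<close>

definition strictly_alternates :: "nat set \<Rightarrow> (nat \<Rightarrow> real) \<Rightarrow> nat \<Rightarrow> bool" where
  "strictly_alternates I x r \<longleftrightarrow> (\<exists>\<sigma> i. (\<sigma> = 1 \<or> \<sigma> = -1) \<and> strict_mono_on {..r} i \<and> i ` {..r} \<subseteq> I \<and>
    (\<forall>t\<le>r. \<sigma> * (-1) ^ t * x (i t) > 0))"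

text \<open>The companion S^+(x) >= r: each zero may take whichever sign helps.\<close>

definition weakly_alternates :: "nat set \<Rightarrow> (nat \<Rightarrow> real) \<Rightarrow> nat \<Rightarrow> bool" where
  "weakly_alternates I x r \<longleftrightarrow> (\<exists>\<sigma> i. (\<sigma> = 1 \<or> \<sigma> = -1) \<and> strict_mono_on {..r} i \<and> i ` {..r} \<subseteq> I \<and>
    (\<forall>t\<le>r. \<sigma> * (-1) ^ t * x (i t) \<ge> 0))"

lemma strictly_alternates_0:
  assumes "p \<in> I" "x p \<noteq> 0"
  shows "strictly_alternates I x 0"
  unfolding strictly_alternates_def using assms
  by (intro exI[of _ "sgn (x p)"] exI[of _ "\<lambda>_. p"])
    (auto simp: strict_mono_on_def sgn_if)

lemma strictly_alternates_mono:
  assumes "strictly_alternates I x r" "r' \<le> r"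
  shows "strictly_alternates I x r'"
proof -
  obtain \<sigma> i where i: "\<sigma> = 1 \<or> \<sigma> = -1" "strict_mono_on {..r} i" "i ` {..r} \<subseteq> I"
      "\<forall>t\<le>r. \<sigma> * (-1) ^ t * x (i t) > 0"
    using assms(1) unfolding strictly_alternates_def by blast
  have "strict_mono_on {..r'} i" "i ` {..r'} \<subseteq> I" "\<forall>t\<le>r'. \<sigma> * (-1) ^ t * x (i t) > 0"
    using i assms(2) by (auto simp: strict_mono_on_def)
  then show ?thesis using i(1) unfolding strictly_alternates_def by blast
qed

lemma strictly_imp_weakly_alternates: "strictly_alternates I x r \<Longrightarrow> weakly_alternates I x r"
  unfolding strictly_alternates_def weakly_alternates_def using less_imp_le by blast

text \<open>A zero at the last index continues any alternation; the spectral arguments rest on this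
  gain of one.\<close>

lemma weakly_alternates_extend_zero:
  assumes "strictly_alternates I x r" "q \<in> I" "\<And>p. p \<in> I \<Longrightarrow> p \<le> q" "x q = 0"
  shows "weakly_alternates I x (Suc r)"
proof -
  obtain \<sigma> i where i: "\<sigma> = 1 \<or> \<sigma> = -1" "strict_mono_on {..r} i" "i ` {..r} \<subseteq> I"
      "\<forall>t\<le>r. \<sigma> * (-1) ^ t * x (i t) > 0"
    using assms(1) unfolding strictly_alternates_def by blast
  have lt: "i t < q" if "t \<le> r" for t
  proof -
    have "i t \<noteq> q" using i(4) that assms(4) by (metis less_irrefl mult_zero_right)
    moreover have "i t \<in> I" using i(3) that by auto
    ultimately show ?thesis using assms(3)[of "i t"] by simp
  qed
  define i' where "i' t = (if t \<le> r then i t else q)" for t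
  have "strict_mono_on {..Suc r} i'"
    using i(2) lt by (auto simp: strict_mono_on_def i'_def le_Suc_eq)
  moreover have "i' ` {..Suc r} \<subseteq> I" using i(3) assms(2) by (auto simp: i'_def)
  moreover have "\<forall>t\<le>Suc r. \<sigma> * (-1) ^ t * x (i' t) \<ge> 0"
    using i(4) assms(4) by (auto simp: i'_def le_Suc_eq less_imp_le)
  ultimately show ?thesis using i(1) unfolding weakly_alternates_def by blast
qed

lemma strictly_alternates_less_card:
  assumes "strictly_alternates I x r" "finite I"
  shows "r < card I"
proof -
  obtain i :: "nat \<Rightarrow> nat" where i: "strict_mono_on {..r} i" "i ` {..r} \<subseteq> I"
    using assms(1) unfolding strictly_alternates_def by blast
  have "card {..r} \<le> card I"
    using strict_mono_on_imp_inj_on[OF i(1)] i(2) assms(2) by (rule card_inj_on_le)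
  then show ?thesis by simp
qed

text \<open>Lower semicontinuity of S^-: \<open>x\<close> stands for a perturbation of
  \<open>h\<close>, arbitrary where \<open>h\<close> vanishes.\<close>

lemma strictly_alternates_sign:
  assumes "strictly_alternates I h r" "\<And>p. p \<in> I \<Longrightarrow> (h p > 0 \<longrightarrow> x p > 0) \<and> (h p < 0 \<longrightarrow> x p < 0)"
  shows "strictly_alternates I x r"
proof -
  obtain \<sigma> i where i: "\<sigma> = 1 \<or> \<sigma> = -1" "strict_mono_on {..r} i" "i ` {..r} \<subseteq> I"
      "\<forall>t\<le>r. \<sigma> * (-1) ^ t * h (i t) > 0"
    using assms(1) unfolding strictly_alternates_def by blast
  have "\<sigma> * (-1) ^ t * x (i t) > 0" if "t \<le> r" for t
    using i(4)[rule_format, OF that] assms(2)[of "i t"] i(1,3) that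
    by (cases "even t") (auto simp: image_subset_iff)
  then show ?thesis using i unfolding strictly_alternates_def by blast
qed

text \<open>Upper semicontinuity: an alternation of the perturbation \<open>x\<close> uses signs of
  \<open>h\<close> or places where \<open>h\<close> vanishes, and the weak count admits
  both.\<close>

lemma weakly_alternates_sign:
  assumes "strictly_alternates I x r" "\<And>p. p \<in> I \<Longrightarrow> (h p > 0 \<longrightarrow> x p > 0) \<and> (h p < 0 \<longrightarrow> x p < 0)"
  shows "weakly_alternates I h r"
proof -
  obtain \<sigma> i where i: "\<sigma> = 1 \<or> \<sigma> = -1" "strict_mono_on {..r} i" "i ` {..r} \<subseteq> I"
      "\<forall>t\<le>r. \<sigma> * (-1) ^ t * x (i t) > 0"
    using assms(1) unfolding strictly_alternates_def by blast
  have "\<sigma> * (-1) ^ t * h (i t) \<ge> 0" if "t \<le> r" for t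
    using i(4)[rule_format, OF that] assms(2)[of "i t"] i(1,3) that
    by (cases "even t"; cases "h (i t)" "0::real" rule: linorder_cases) (auto simp: image_subset_iff)
  then show ?thesis using i unfolding weakly_alternates_def by blast
qed

lemma weakly_alternates_scale:
  assumes "weakly_alternates I x r" "c \<noteq> 0" "\<And>p. p \<in> I \<Longrightarrow> y p = c * x p"
  shows "weakly_alternates I y r"
proof -
  obtain \<sigma> i where i: "\<sigma> = 1 \<or> \<sigma> = -1" "strict_mono_on {..r} i" "i ` {..r} \<subseteq> I"
      "\<forall>t\<le>r. \<sigma> * (-1) ^ t * x (i t) \<ge> 0"
    using assms(1) unfolding weakly_alternates_def by blast
  have "(sgn c * \<sigma>) * (-1) ^ t * y (i t) \<ge> 0" if "t \<le> r" for t
  proof -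
    have eq: "(sgn c * \<sigma>) * (-1) ^ t * y (i t) = \<bar>c\<bar> * (\<sigma> * (-1) ^ t * x (i t))"
      using assms(3)[of "i t"] i(3) that by (auto simp: abs_sgn image_subset_iff)
    show ?thesis unfolding eq using i(4) that by simp
  qed
  moreover have "sgn c * \<sigma> = 1 \<or> sgn c * \<sigma> = -1" using i(1) assms(2) by (auto simp: sgn_if)
  ultimately show ?thesis using i(2,3) unfolding weakly_alternates_def by blast
qed

lemma strictly_alternates_scale:
  assumes "strictly_alternates I x r" "c \<noteq> 0" "\<And>p. p \<in> I \<Longrightarrow> y p = c * x p"
  shows "strictly_alternates I y r"
proof -
  obtain \<sigma> i where i: "\<sigma> = 1 \<or> \<sigma> = -1" "strict_mono_on {..r} i" "i ` {..r} \<subseteq> I"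
      "\<forall>t\<le>r. \<sigma> * (-1) ^ t * x (i t) > 0"
    using assms(1) unfolding strictly_alternates_def by blast
  have "(sgn c * \<sigma>) * (-1) ^ t * y (i t) > 0" if "t \<le> r" for t
  proof -
    have eq: "(sgn c * \<sigma>) * (-1) ^ t * y (i t) = \<bar>c\<bar> * (\<sigma> * (-1) ^ t * x (i t))"
      using assms(3)[of "i t"] i(3) that by (auto simp: abs_sgn image_subset_iff)
    show ?thesis unfolding eq using i(4) that assms(2) by simp
  qed
  moreover have "sgn c * \<sigma> = 1 \<or> sgn c * \<sigma> = -1" using i(1) assms(2) by (auto simp: sgn_if)
  ultimately show ?thesis using i(2,3) unfolding strictly_alternates_def by blast
qed

text \<open>\<open>R\<close> has one separator between consecutive sign blocks of \<open>x\<close>,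
  on the scale of \<open>\<nu>\<close>. Signs are counted from the right end, where the product over
  \<open>R\<close> is positive, so \<open>\<sigma>\<close> is the sign of the last block. Nodes on
  both sides of each separator fix the sign of the product beyond the ends.\<close>

lemma sign_separating_roots:
  fixes \<nu> x :: "nat \<Rightarrow> real"
  assumes "finite I" "strict_mono_on I \<nu>" "\<exists>p\<in>I. x p \<noteq> 0"
  shows "\<exists>R \<sigma> i. finite R \<and> (\<forall>\<rho>\<in>R. \<exists>p\<in>I. \<nu> p < \<rho>) \<and> (\<forall>\<rho>\<in>R. \<exists>p\<in>I. \<rho> < \<nu> p) \<and> (\<sigma> = 1 \<or> \<sigma> = -1) \<and>
    (\<forall>p\<in>I. x p \<noteq> 0 \<longrightarrow> \<sigma> * x p * (\<Prod>\<rho>\<in>R. \<nu> p - \<rho>) > 0) \<and>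
    strict_mono_on {..card R} i \<and> i ` {..card R} \<subseteq> I \<and> (\<forall>t\<le>card R. \<sigma> * (-1) ^ (card R - t) * x (i t) > 0)"
  using assms
proof (induction I rule: finite_linorder_max_induct)
  case (insert b A)
  have \<nu>A: "strict_mono_on A \<nu>" using insert.prems(1) by (auto simp: strict_mono_on_def)
  have \<nu>b: "\<nu> p < \<nu> b" if "p \<in> A" for p
    using insert.prems(1) insert.hyps(2) that by (auto simp: strict_mono_on_def)
  show ?case
  proof (cases "\<exists>p\<in>A. x p \<noteq> 0")
    case False
    then have "x b \<noteq> 0" using insert.prems(2) by auto
    then show ?thesis using False
      by (intro exI[of _ "{}"] exI[of _ "sgn (x b)"] exI[of _ "\<lambda>_. b"]) (auto simp: sgn_if strict_mono_on_def)
  next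
    case True
    obtain R \<sigma> i where R: "finite R" "\<forall>\<rho>\<in>R. \<exists>p\<in>A. \<nu> p < \<rho>" "\<forall>\<rho>\<in>R. \<exists>p\<in>A. \<rho> < \<nu> p" "\<sigma> = 1 \<or> \<sigma> = -1"
      and sep: "\<forall>p\<in>A. x p \<noteq> 0 \<longrightarrow> \<sigma> * x p * (\<Prod>\<rho>\<in>R. \<nu> p - \<rho>) > 0"
      and i: "strict_mono_on {..card R} i" "i ` {..card R} \<subseteq> A" "\<forall>t\<le>card R. \<sigma> * (-1) ^ (card R - t) * x (i t) > 0"
      using insert.IH[OF \<nu>A True] by blast
    have prb: "(\<Prod>\<rho>\<in>R. \<nu> b - \<rho>) > 0" using R(3) \<nu>b by (intro prod_pos) force
    show ?thesis
    proof (cases "\<sigma> * x b \<ge> 0")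
      case True
      then have "\<sigma> * x b > 0" if "x b \<noteq> 0" using that R(4) by auto
      then have "\<forall>p\<in>insert b A. x p \<noteq> 0 \<longrightarrow> \<sigma> * x p * (\<Prod>\<rho>\<in>R. \<nu> p - \<rho>) > 0"
        using sep prb mult_pos_pos by blast
      then show ?thesis using R i by (intro exI[of _ R] exI[of _ \<sigma>] exI[of _ i]) auto
    next
      case False
      have A: "A \<noteq> {}" using i(2) by auto
      \<comment> \<open>A new sign block opens at \<open>b\<close>: a separator goes midway before
        \<open>\<nu> b\<close>, and the sign flips.\<close>
      define \<rho>0 where "\<rho>0 = (\<nu> (Max A) + \<nu> b) / 2"
      have M: "Max A \<in> A" using A insert.hyps(1) by simp
      have "\<nu> p \<le> \<nu> (Max A)" if "p \<in> A" for p
        using strict_mono_on_leD[OF \<nu>A that M] insert.hyps(1) that by simp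
      then have \<rho>0: "\<nu> p < \<rho>0" if "p \<in> A" for p using \<nu>b[OF M] that unfolding \<rho>0_def by force
      have \<rho>0b: "\<rho>0 < \<nu> b" using \<nu>b[OF M] unfolding \<rho>0_def by simp
      have notin: "\<rho>0 \<notin> R" using R(3) \<rho>0 by force
      have cR: "card (insert \<rho>0 R) = Suc (card R)" using notin R(1) by simp
      have lt: "i t < b" if "t \<le> card R" for t using i(2) insert.hyps(2) that by auto
      define i' where "i' = i(Suc (card R) := b)"
      have "strict_mono_on {..Suc (card R)} i'"
        using i(1) lt by (auto simp: strict_mono_on_def i'_def le_Suc_eq)
      moreover have "i' ` {..Suc (card R)} \<subseteq> insert b A"
        using i(2) by (auto simp: i'_def le_Suc_eq image_subset_iff)
      moreover have "\<forall>t\<le>Suc (card R). - \<sigma> * (-1) ^ (Suc (card R) - t) * x (i' t) > 0"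
        using i(3) False by (auto simp: i'_def le_Suc_eq Suc_diff_le)
      moreover have "\<forall>p\<in>insert b A. x p \<noteq> 0 \<longrightarrow> - \<sigma> * x p * (\<Prod>\<rho>\<in>insert \<rho>0 R. \<nu> p - \<rho>) > 0"
      proof (intro ballI impI)
        fix p assume p: "p \<in> insert b A" "x p \<noteq> 0"
        have e: "- \<sigma> * x p * (\<Prod>\<rho>\<in>insert \<rho>0 R. \<nu> p - \<rho>) = (\<rho>0 - \<nu> p) * (\<sigma> * x p * (\<Prod>\<rho>\<in>R. \<nu> p - \<rho>))"
          using notin R(1) by (simp add: algebra_simps)
        show "- \<sigma> * x p * (\<Prod>\<rho>\<in>insert \<rho>0 R. \<nu> p - \<rho>) > 0"
        proof (cases "p = b")
          case True
          then have "\<sigma> * x p * (\<Prod>\<rho>\<in>R. \<nu> p - \<rho>) < 0" "\<rho>0 - \<nu> p < 0" using prb False \<rho>0b by (auto intro: mult_neg_pos)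
          then show ?thesis unfolding e by (intro mult_neg_neg)
        next
          case False
          then have pA: "p \<in> A" using p(1) by simp
          then have "\<rho>0 - \<nu> p > 0" using \<rho>0 by simp
          then show ?thesis unfolding e by (rule mult_pos_pos[OF _ sep[rule_format, OF pA p(2)]])
        qed
      qed
      ultimately show ?thesis using R \<rho>0 \<rho>0b M
        by (intro exI[of _ "insert \<rho>0 R"] exI[of _ "- \<sigma>"] exI[of _ i']) (auto simp: cR simp del: card_insert_disjoint)
    qed
  qed
qed simp

lemma lagrange_interpolation_poly:
  fixes g :: "'a::field poly"
  assumes "finite T" "inj_on u T" "degree g < card T"
  shows "g = (\<Sum>t\<in>T. Polynomial.smult (poly g (u t) / (\<Prod>s\<in>T - {t}. u t - u s)) (\<Prod>s\<in>T - {t}. [:- u s, 1:]))"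
    (is "_ = ?h")
proof (rule ccontr)
  assume "g \<noteq> ?h"
  then have Q: "g - ?h \<noteq> 0" by simp
  have "poly ?h (u t) = poly g (u t)" if t: "t \<in> T" for t
  proof -
    have "poly ?h (u t) = (\<Sum>r\<in>T. if r = t then poly g (u t) else 0)"
      unfolding poly_sum
    proof (intro sum.cong refl)
      fix r assume r: "r \<in> T"
      have "(\<Prod>s\<in>T - {t}. u t - u s) \<noteq> 0" using assms(1,2) t by (auto simp: inj_on_def)
      moreover have "(\<Prod>s\<in>T - {r}. u t - u s) = 0" if "r \<noteq> t"
        using assms(1) t that by (intro prod_zero) auto
      ultimately show "poly (Polynomial.smult (poly g (u r) / (\<Prod>s\<in>T - {r}. u r - u s)) (\<Prod>s\<in>T - {r}. [:- u s, 1:])) (u t) =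
          (if r = t then poly g (u t) else 0)"
        by (auto simp: poly_prod)
    qed
    then show ?thesis using assms(1) t by simp
  qed
  then have "u ` T \<subseteq> {x. poly (g - ?h) x = 0}" by auto
  then have "card (u ` T) \<le> card {x. poly (g - ?h) x = 0}" by (intro card_mono poly_roots_finite Q)
  also have "\<dots> \<le> degree (g - ?h)" by (rule card_poly_roots_bound[OF Q])
  also have "degree (g - ?h) \<le> card T - 1"
    using assms by (intro degree_diff_le degree_sum_le) (auto intro!: order.trans[OF degree_smult_le] simp: degree_prod_linear)
  finally show False using assms by (simp add: card_image)
qed

lemma partial_fractions:
  fixes g :: "'a::field poly"
  assumes "finite T" "inj_on u T" "degree g < card T" "\<And>t. t \<in> T \<Longrightarrow> n \<noteq> u t"
  shows "poly g n / (\<Prod>t\<in>T. n - u t) = (\<Sum>t\<in>T. poly g (u t) / (\<Prod>s\<in>T - {t}. u t - u s) / (n - u t))"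
proof -
  have "poly g n = (\<Sum>t\<in>T. poly g (u t) / (\<Prod>s\<in>T - {t}. u t - u s) * (\<Prod>s\<in>T - {t}. n - u s))"
    by (subst lagrange_interpolation_poly[OF assms(1-3)]) (simp add: poly_sum poly_prod)
  moreover have "(\<Prod>s\<in>T - {t}. n - u s) / (\<Prod>s\<in>T. n - u s) = 1 / (n - u t)" if "t \<in> T" for t
  proof -
    have "(\<Prod>s\<in>T - {t}. n - u s) \<noteq> 0" using assms(1,4) by auto
    then show ?thesis using that assms(1) by (subst (2) prod.remove[of _ t]) auto
  qed
  ultimately show ?thesis
    by (simp only: sum_divide_distrib times_divide_eq_right[symmetric]) (auto intro!: sum.cong)
qed

text \<open>
  If the sign changes of \<open>x\<close> are separated by the roots of a polynomial \<open>g\<close>, the partial fraction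
  expansion of \<open>g (\<nu>) / (\<Prod>t. \<nu> - u (j t))\<close> turns an alternation of \<open>y\<close> along \<open>j\<close> that is longer than
  \<open>degree g\<close> into a vanishing or negative sum of positive terms.
\<close>

lemma cauchy_kernel_variation_diminishing:
  fixes \<nu> u a c x :: "nat \<Rightarrow> real"
  assumes fin: "finite I" and \<nu>: "strict_mono_on I \<nu>" and u: "strict_mono_on I u"
    and less: "\<And>p j. p \<in> I \<Longrightarrow> j \<in> I \<Longrightarrow> u j < \<nu> p"
    and pos: "\<And>p. p \<in> I \<Longrightarrow> a p > 0" "\<And>p. p \<in> I \<Longrightarrow> c p > 0"
    and x: "\<exists>p\<in>I. x p \<noteq> 0"
    and alt: "weakly_alternates I (\<lambda>j. \<Sum>p\<in>I. a j * c p / (\<nu> p - u j) * x p) r"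
  shows "strictly_alternates I x r"
proof -
  obtain R \<sigma> i where R: "finite R" "\<forall>\<rho>\<in>R. \<exists>p\<in>I. \<nu> p < \<rho>" "\<sigma> = 1 \<or> \<sigma> = -1"
    and sep: "\<forall>p\<in>I. x p \<noteq> 0 \<longrightarrow> \<sigma> * x p * (\<Prod>\<rho>\<in>R. \<nu> p - \<rho>) > 0"
    and i: "strict_mono_on {..card R} i" "i ` {..card R} \<subseteq> I" "\<forall>t\<le>card R. \<sigma> * (-1) ^ (card R - t) * x (i t) > 0"
    using sign_separating_roots[OF fin \<nu> x] by blast
  define d where "d = card R"
  have "strictly_alternates I x d"
    unfolding strictly_alternates_def
  proof (intro exI[of _ "\<sigma> * (-1) ^ d"] exI[of _ i] conjI allI impI)
    fix t assume t: "t \<le> d"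
    then have "(-1::real) ^ d = (-1) ^ (d - t) * (-1) ^ t" by (simp flip: power_add)
    then have eq: "\<sigma> * (-1) ^ d * (-1) ^ t = \<sigma> * (-1) ^ (d - t)"
      by (simp flip: power_mult_distrib)
    show "\<sigma> * (-1) ^ d * (-1) ^ t * x (i t) > 0" unfolding eq using i(3) t by (simp add: d_def)
  qed (use i R(3) in \<open>auto simp: d_def minus_one_power_iff\<close>)
  moreover have False if "d < r"
  proof -
    obtain \<tau> j where j: "\<tau> = 1 \<or> \<tau> = -1" "strict_mono_on {..r} j" "j ` {..r} \<subseteq> I"
        "\<forall>t\<le>r. \<tau> * (-1) ^ t * (\<Sum>p\<in>I. a (j t) * c p / (\<nu> p - u (j t)) * x p) \<ge> 0"
      using alt unfolding weakly_alternates_def by blast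
    \<comment> \<open>The given alternation has more than \<open>d + 1\<close> members and only
      \<open>d + 1\<close> are used, so skipping the first one or not adjusts the phase to
      \<open>- \<sigma>\<close>.\<close>
    define o' where "o' = (if \<sigma> * \<tau> = -1 then 0 else 1 :: nat)"
    have o': "\<tau> * (-1) ^ o' = - \<sigma>" "o' \<le> 1" using R(3) j(1) by (auto simp: o'_def)
    define v where "v t = u (j (t + o'))" for t
    have jI: "j (t + o') \<in> I" if "t \<le> d" for t using j(3) that \<open>d < r\<close> o'(2) by auto
    have vmono: "strict_mono_on {..<Suc d} v"
    proof (rule strict_mono_onI)
      fix s t assume st: "s \<in> {..<Suc d}" "t \<in> {..<Suc d}" "s < t"
      then have "j (s + o') < j (t + o')" using j(2) \<open>d < r\<close> o'(2) by (auto simp: strict_mono_on_def)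
      then show "v s < v t" using u jI st unfolding v_def by (auto simp: strict_mono_on_def)
    qed
    define g where "g = (\<Prod>\<rho>\<in>R. [:- \<rho>, 1:])"
    define \<phi> where "\<phi> t = (\<Sum>p\<in>I. c p * x p / (\<nu> p - v t))" for t
    define D where "D t = poly g (v t) / (\<Prod>s\<in>{..<Suc d} - {t}. v t - v s)" for t
    have pf: "poly g (\<nu> p) / (\<Prod>t<Suc d. \<nu> p - v t) = (\<Sum>t<Suc d. D t / (\<nu> p - v t))" if p: "p \<in> I" for p
      unfolding D_def
    proof (rule partial_fractions)
      show "\<nu> p \<noteq> v t" if "t \<in> {..<Suc d}" for t using less[OF p jI[of t]] that by (auto simp: v_def)
    qed (use strict_mono_on_imp_inj_on[OF vmono] degree_prod_linear[of "\<lambda>x. x" R] in \<open>auto simp: g_def d_def\<close>)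
    \<comment> \<open>This sum is evaluated twice: positive term by term over \<open>I\<close>,
      nonpositive after expansion into partial fractions.\<close>
    have "0 < (\<Sum>p\<in>I. c p * (\<sigma> * x p * poly g (\<nu> p)) / (\<Prod>t<Suc d. \<nu> p - v t))"
    proof -
      have den: "(\<Prod>t<Suc d. \<nu> p - v t) > 0" if "p \<in> I" for p
        using less[OF that jI] by (intro prod_pos) (auto simp: v_def)
      have gp: "poly g (\<nu> p) = (\<Prod>\<rho>\<in>R. \<nu> p - \<rho>)" for p by (simp add: g_def poly_prod)
      have term_pos: "0 < c p * (\<sigma> * x p * poly g (\<nu> p)) / (\<Prod>t<Suc d. \<nu> p - v t)" if "p \<in> I" "x p \<noteq> 0" for p
        unfolding gp by (rule divide_pos_pos[OF mult_pos_pos[OF pos(2)[OF that(1)] sep[rule_format, OF that]] den[OF that(1)]])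
      obtain p where p: "p \<in> I" "x p \<noteq> 0" using x by blast
      show ?thesis
      proof (rule sum_pos2[OF fin p(1)])
        show "0 < c p * (\<sigma> * x p * poly g (\<nu> p)) / (\<Prod>t<Suc d. \<nu> p - v t)"
          by (rule term_pos[OF p])
        fix p assume "p \<in> I"
        then show "0 \<le> c p * (\<sigma> * x p * poly g (\<nu> p)) / (\<Prod>t<Suc d. \<nu> p - v t)"
          using less_imp_le[OF term_pos[of p]] by (cases "x p = 0") auto
      qed
    qed
    also have "\<dots> = (\<Sum>p\<in>I. \<Sum>t<Suc d. \<sigma> * D t * (c p * x p / (\<nu> p - v t)))"
    proof (intro sum.cong refl)
      fix p assume p: "p \<in> I"
      have "c p * (\<sigma> * x p * poly g (\<nu> p)) / (\<Prod>t<Suc d. \<nu> p - v t) = c p * \<sigma> * x p * (poly g (\<nu> p) / (\<Prod>t<Suc d. \<nu> p - v t))"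
        by simp
      then show "c p * (\<sigma> * x p * poly g (\<nu> p)) / (\<Prod>t<Suc d. \<nu> p - v t) = (\<Sum>t<Suc d. \<sigma> * D t * (c p * x p / (\<nu> p - v t)))"
        unfolding pf[OF p] sum_distrib_left by (simp add: mult_ac)
    qed
    also have "\<dots> = (\<Sum>t<Suc d. \<sigma> * D t * \<phi> t)"
      unfolding \<phi>_def sum_distrib_left by (rule sum.swap)
    also have "\<dots> \<le> 0"
    proof (rule sum_nonpos)
      fix t assume "t \<in> {..<Suc d}"
      then have t: "t \<le> d" by simp
      have aj: "a (j (t + o')) > 0" using pos(1) jI[OF t] by simp
      have "(\<Sum>p\<in>I. a (j (t + o')) * c p / (\<nu> p - u (j (t + o'))) * x p) = a (j (t + o')) * \<phi> t"
        unfolding \<phi>_def v_def sum_distrib_left by (intro sum.cong) auto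
      with j(4)[rule_format, of "t + o'"] t \<open>d < r\<close> o'(2)
      have "0 \<le> \<tau> * (-1) ^ (t + o') * (a (j (t + o')) * \<phi> t)" by simp
      also have "\<dots> = a (j (t + o')) * ((\<tau> * (-1) ^ o') * (-1) ^ t * \<phi> t)" by (simp add: power_add)
      finally have phi: "\<sigma> * (-1) ^ t * \<phi> t \<le> 0" using aj unfolding o'(1)
        by (simp add: mult_le_0_iff[of "a (j (t + o'))" "\<sigma> * (-1) ^ t * \<phi> t"])
      have "poly g (v t) = (\<Prod>\<rho>\<in>R. (-1) * (\<rho> - v t))" by (simp add: g_def poly_prod)
      also have "\<dots> = (-1) ^ d * (\<Prod>\<rho>\<in>R. \<rho> - v t)" unfolding prod.distrib by (simp add: d_def)
      finally have gv: "poly g (v t) = (-1) ^ d * (\<Prod>\<rho>\<in>R. \<rho> - v t)" .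
      \<comment> \<open>Each root of \<open>g\<close> lies above some \<open>\<nu> p\<close>, hence
        above every \<open>u j\<close>.\<close>
      have gpos: "(\<Prod>\<rho>\<in>R. \<rho> - v t) > 0"
        using R(2) less[OF _ jI[OF t]] by (intro prod_pos) (force simp: v_def)
      have den: "(-1) ^ (d - t) * (\<Prod>s\<in>{..<Suc d} - {t}. v t - v s) > 0"
        using prod_diff_sign_pos[OF vmono, of t] t by simp
      have "(-1::real) ^ d = (-1) ^ t * (-1) ^ (d - t)" using t by (simp flip: power_add)
      moreover have "1 / (-1::real) ^ (d - t) = (-1) ^ (d - t)" by (simp add: minus_one_power_iff)
      ultimately have "D t = (-1) ^ t * ((\<Prod>\<rho>\<in>R. \<rho> - v t) / ((-1) ^ (d - t) * (\<Prod>s\<in>{..<Suc d} - {t}. v t - v s)))"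
        unfolding D_def gv by (simp add: divide_inverse mult_ac)
      then have "\<sigma> * D t * \<phi> t = (\<sigma> * (-1) ^ t * \<phi> t) * ((\<Prod>\<rho>\<in>R. \<rho> - v t) / ((-1) ^ (d - t) * (\<Prod>s\<in>{..<Suc d} - {t}. v t - v s)))"
        by (simp add: mult_ac)
      also have "\<dots> \<le> 0"
        by (rule mult_nonpos_nonneg[OF phi divide_nonneg_pos[OF less_imp_le[OF gpos] den]])
      finally show "\<sigma> * D t * \<phi> t \<le> 0" .
    qed
    finally show False by simp
  qed
  ultimately show ?thesis using strictly_alternates_mono by (metis not_less)
qed

section \<open>Recurrence and the spectrum of a variation diminishing kernel\<close>

lemma unit_complex_recurrence:
  fixes w :: complex
  assumes "norm w = 1" "\<epsilon> > 0"
  obtains k :: nat where "k \<ge> 1" "norm (w ^ k - 1) < \<epsilon>"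
proof -
  \<comment> \<open>By compactness two powers of \<open>w\<close> come close to each other; their
    quotient is a power close to 1.\<close>
  obtain f z where f: "strict_mono (f :: nat \<Rightarrow> nat)" "\<forall>e>0. \<exists>N. \<forall>n\<ge>N. norm (w ^ f n - z) < e"
    using Bolzano_Weierstrass_complex_disc[of "\<lambda>n. w ^ n" 1] assms(1) by (auto simp: norm_power)
  obtain N where N: "\<And>n. n \<ge> N \<Longrightarrow> norm (w ^ f n - z) < \<epsilon> / 2"
    using f(2) assms(2) by (meson half_gt_zero)
  define k where "k = f (Suc N) - f N"
  have lt: "f N < f (Suc N)" using f(1) by (simp add: strict_mono_def)
  then have "w ^ f (Suc N) = w ^ f N * w ^ k" by (simp add: k_def flip: power_add)
  then have "norm (w ^ f N) * norm (w ^ k - 1) = norm ((w ^ f (Suc N) - z) - (w ^ f N - z))"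
    by (simp add: norm_mult[symmetric] algebra_simps)
  also have "\<dots> < \<epsilon>"
    using norm_triangle_ineq4[of "w ^ f (Suc N) - z" "w ^ f N - z"] N[of N] N[of "Suc N"] by simp
  finally have "norm (w ^ k - 1) < \<epsilon>" using assms(1) by (simp add: norm_power)
  then show ?thesis using that[of k] lt by (simp add: k_def)
qed

text \<open>\<open>vd\<close> says S^+(K x) <= S^-(x) for \<open>x\<close> not zero on
  \<open>I\<close>, and \<open>q\<close> is the last index; the Cauchy form of the kernel is not
  visible here.\<close>

context
  fixes I :: "nat set" and K :: "nat \<Rightarrow> nat \<Rightarrow> real" and q :: nat
  assumes fin: "finite I" and q: "q \<in> I" "\<And>p. p \<in> I \<Longrightarrow> p \<le> q"
    and vd: "\<And>x r. \<exists>p\<in>I. x p \<noteq> 0 \<Longrightarrow> weakly_alternates I (\<lambda>j. \<Sum>p\<in>I. K j p * x p) r \<Longrightarrow> strictly_alternates I x r"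
begin

lemma preimage_alternates:
  assumes "\<exists>p\<in>I. x p \<noteq> 0" "c \<noteq> 0" "\<And>j. j \<in> I \<Longrightarrow> (\<Sum>p\<in>I. K j p * x p) = c * y j" "weakly_alternates I y r"
  shows "strictly_alternates I x r"
  by (rule vd[OF assms(1)], rule weakly_alternates_scale[OF assms(4,2,3)])

lemma no_unbounded_alternation:
  assumes "\<exists>p\<in>I. x p \<noteq> 0" "\<And>r. strictly_alternates I x r \<Longrightarrow> strictly_alternates I x (Suc r)"
  shows False
proof -
  have "strictly_alternates I x r" for r
    using assms strictly_alternates_0 by (induction r) blast+
  then show False using strictly_alternates_less_card[OF _ fin] by blast
qed

text \<open>A zero at \<open>q\<close> puts the weak count above the strict one, but an eigenvector
  is its own image up to a factor, so the kernel forces the opposite inequality.\<close>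

lemma real_eigenvector_last_nonzero:
  assumes "\<exists>p\<in>I. x p \<noteq> 0" "c \<noteq> 0" "\<And>j. j \<in> I \<Longrightarrow> (\<Sum>p\<in>I. K j p * x p) = c * x j"
  shows "x q \<noteq> 0"
proof
  assume "x q = 0"
  then show False
    using no_unbounded_alternation[OF assms(1)] preimage_alternates[OF assms]
      weakly_alternates_extend_zero[OF _ q] by blast
qed

text \<open>On the line f + t h the kernel is, up to a factor, the translation by b / c, and both
  ends of the line point along \<open>h\<close>. The path goes from t = 0 backwards to one end,
  through \<open>h\<close>, and from the other end back to 0. No sign change is lost on the way, and
  the zero at \<open>q\<close> gains one at the start.\<close>

lemma no_real_jordan_block:
  assumes h: "\<exists>p\<in>I. h p \<noteq> 0" and "c \<noteq> 0" "\<And>j. j \<in> I \<Longrightarrow> (\<Sum>p\<in>I. K j p * h p) = c * h j"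
    and f: "f q = 0" "\<And>j. j \<in> I \<Longrightarrow> (\<Sum>p\<in>I. K j p * f p) = c * f j + b * h j" "b \<noteq> 0"
  shows False
proof -
  have hq: "h q \<noteq> 0" by (rule real_eigenvector_last_nonzero[OF assms(1-3)])
  define g where "g t p = f p + t * h p" for t p
  define \<gamma> where "\<gamma> = b / c"
  have \<gamma>: "\<gamma> \<noteq> 0" using assms by (simp add: \<gamma>_def)
  have app: "(\<Sum>p\<in>I. K j p * g t p) = c * g (t + \<gamma>) j" if "j \<in> I" for t j
  proof -
    have "(\<Sum>p\<in>I. K j p * g t p) = (\<Sum>p\<in>I. K j p * f p) + t * (\<Sum>p\<in>I. K j p * h p)"
      by (simp add: g_def sum.distrib sum_distrib_left algebra_simps)
    then show ?thesis using assms(2,3) f(2) that by (simp add: g_def \<gamma>_def field_simps)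
  qed
  have nz: "\<exists>p\<in>I. g t p \<noteq> 0" for t
  proof (cases "t = 0")
    case True
    show ?thesis
    proof (rule ccontr)
      assume "\<not> (\<exists>p\<in>I. g t p \<noteq> 0)"
      then have "\<forall>p\<in>I. f p = 0" using True by (simp add: g_def)
      then show False using f(2)[OF q(1)] q(1) f(3) hq by simp
    qed
  next
    case False
    then show ?thesis using hq f(1) q(1) by (intro bexI[of _ q]) (auto simp: g_def)
  qed
  have step: "strictly_alternates I (g t) r" if "weakly_alternates I (g (t + \<gamma>)) r" for t r
    by (rule preimage_alternates[OF nz assms(2) app that])
  have descend: "strictly_alternates I (g (t - real n * \<gamma>)) r" if "strictly_alternates I (g t) r" for t r n
  proof (induction n)
    case (Suc n)
    then show ?case
      using step[of "t - real (Suc n) * \<gamma>" r] strictly_imp_weakly_alternates by (simp add: algebra_simps)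
  qed (use that in simp)
  \<comment> \<open>For |t| >= T the term t h dominates f wherever \<open>h\<close> is nonzero;
    where \<open>h p = 0\<close> the summand is 0 by division by zero.\<close>
  define T where "T = (\<Sum>p\<in>I. \<bar>f p / h p\<bar>) + 1"
  obtain n :: nat where n: "T \<le> real n * \<bar>\<gamma>\<bar>" "n \<ge> 1"
  proof -
    obtain n :: nat where "T / \<bar>\<gamma>\<bar> < real n" using reals_Archimedean2 by blast
    then have "T \<le> real (Suc n) * \<bar>\<gamma>\<bar>" using \<gamma> by (simp add: field_simps add_increasing2)
    then show ?thesis using that[of "Suc n"] by simp
  qed
  have near: "(h p > 0 \<longrightarrow> inverse t * g t p > 0) \<and> (h p < 0 \<longrightarrow> inverse t * g t p < 0)" if "p \<in> I" "\<bar>t\<bar> \<ge> T" for p t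
  proof (cases "h p = 0")
    case False
    have T: "T > 0" unfolding T_def by (intro add_nonneg_pos sum_nonneg) auto
    have "\<bar>f p / h p\<bar> \<le> (\<Sum>p\<in>I. \<bar>f p / h p\<bar>)" using that(1) fin by (intro member_le_sum) auto
    then have "\<bar>f p / h p\<bar> < \<bar>t\<bar>" using that(2) by (simp add: T_def)
    then have "\<bar>f p / h p\<bar> / \<bar>t\<bar> < 1" using that(2) T by (subst divide_less_eq_1_pos) auto
    then have "\<bar>f p / h p / t\<bar> < 1" by (simp only: abs_divide)
    then have "f p / h p / t + 1 > 0" by linarith
    moreover have "inverse t * g t p = h p * (f p / h p / t + 1)"
      using False that(2) T by (simp add: g_def field_simps)
    ultimately show ?thesis by (simp add: zero_less_mult_iff mult_less_0_iff)
  qed simp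
  have T: "\<bar>real n * \<gamma>\<bar> \<ge> T" "\<bar>- (real n * \<gamma>)\<bar> \<ge> T" "real n * \<gamma> \<noteq> 0" using n \<gamma> by (simp_all add: abs_mult)
  have "strictly_alternates I (g 0) (Suc r)" if "strictly_alternates I (g 0) r" for r
  proof -
    have "weakly_alternates I (g 0) (Suc r)"
      by (rule weakly_alternates_extend_zero[OF that q]) (simp_all add: g_def f(1))
    then have "strictly_alternates I (g (- \<gamma>)) (Suc r)" using step[of "- \<gamma>"] by simp
    from descend[OF this, of "n - 1"] have "strictly_alternates I (g (- (real n * \<gamma>))) (Suc r)"
      using n(2) by (simp add: algebra_simps of_nat_diff)
    then have "strictly_alternates I (\<lambda>p. inverse (- (real n * \<gamma>)) * g (- (real n * \<gamma>)) p) (Suc r)"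
      by (rule strictly_alternates_scale[where c = "inverse (- (real n * \<gamma>))"]) (use T(3) in auto)
    then have "weakly_alternates I h (Suc r)"
      by (rule weakly_alternates_sign) (rule near[OF _ T(2)])
    then have "strictly_alternates I h (Suc r)" 
      using preimage_alternates[where x = h and y = h, OF assms(1-3)] by blast
    then have "strictly_alternates I (\<lambda>p. inverse (real n * \<gamma>) * g (real n * \<gamma>) p) (Suc r)"
      by (rule strictly_alternates_sign) (rule near[OF _ T(1)])
    then have "strictly_alternates I (g (real n * \<gamma>)) (Suc r)"
      by (rule strictly_alternates_scale[where c = "real n * \<gamma>"], intro T(3))
        (simp only: mult.assoc[symmetric] right_inverse[OF T(3)] mult_1)
    from descend[OF this, of n] show ?thesis by simp
  qed
  then show False by (rule no_unbounded_alternation[OF nz])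
qed

text \<open>The real parts of multiples of c^n v form an orbit of \<open>K\<close>. Since the powers
  of c / |c| return near 1, the orbit returns near its starting direction.\<close>

lemma no_nonreal_eigenvector:
  fixes v :: "nat \<Rightarrow> complex"
  assumes v: "\<exists>p\<in>I. v p \<noteq> 0" and ev: "\<And>j. j \<in> I \<Longrightarrow> (\<Sum>p\<in>I. of_real (K j p) * v p) = c * v j"
    and c: "Im c \<noteq> 0"
  shows False
proof -
  have c0: "c \<noteq> 0" using c by auto
  \<comment> \<open>This choice makes the entry at \<open>q\<close> vanish at time 1, not 0: one
    step back to time 0 turns the gained weak change into a strict one, and strict changes survive
    the approximate return at time \<open>k\<close>.\<close>
  define \<alpha> where "\<alpha> = (if v q = 0 then 1 else \<i> * cnj (v q)) / c"
  define f where "f n p = Re (\<alpha> * c ^ n * v p)" for n p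
  have \<alpha>: "\<alpha> \<noteq> 0" using c0 by (simp add: \<alpha>_def)
  have app: "(\<Sum>p\<in>I. K j p * f n p) = f (Suc n) j" if "j \<in> I" for n j
  proof -
    have "(\<Sum>p\<in>I. K j p * f n p) = Re (\<alpha> * c ^ n * (\<Sum>p\<in>I. of_real (K j p) * v p))"
      unfolding sum_distrib_left Re_sum f_def
      by (intro sum.cong refl) (simp add: mult.left_commute[of _ "complex_of_real _"])
    then show ?thesis unfolding ev[OF that] by (simp add: f_def mult_ac)
  qed
  have fq: "f 1 q = 0" using c0 by (simp add: f_def \<alpha>_def)
  \<comment> \<open>Otherwise some nonzero number and its product with the nonreal \<open>c\<close>
    would both be purely imaginary.\<close>
  have nz: "\<exists>p\<in>I. f n p \<noteq> 0" for n
  proof (rule ccontr)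
    assume "\<not> (\<exists>p\<in>I. f n p \<noteq> 0)"
    then have z: "\<forall>p\<in>I. f n p = 0" by blast
    obtain p where p: "p \<in> I" "v p \<noteq> 0" using v by blast
    have "f (Suc n) p = 0" using app[OF p(1), of n] z by simp
    then have "Re (c * (\<alpha> * c ^ n * v p)) = 0" by (simp add: f_def mult_ac)
    moreover have "Re (\<alpha> * c ^ n * v p) = 0" using z p(1) by (simp add: f_def)
    ultimately have "Im (\<alpha> * c ^ n * v p) = 0" using c by simp
    then have "\<alpha> * c ^ n * v p = 0" using \<open>Re (\<alpha> * c ^ n * v p) = 0\<close> by (simp add: complex_eq_iff)
    then show False using \<alpha> c0 p(2) by simp
  qed
  have step: "strictly_alternates I (f n) r" if "weakly_alternates I (f (Suc n)) r" for n r
    by (rule preimage_alternates[OF nz _ _ that, of 1]) (simp_all add: app)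
  have descend: "strictly_alternates I (f (m + n)) r \<Longrightarrow> strictly_alternates I (f m) r" for m n r
  proof (induction n)
    case (Suc n)
    then have "strictly_alternates I (f (m + n)) r"
      using step[of "m + n" r] strictly_imp_weakly_alternates by simp
    then show ?case by (rule Suc.IH)
  qed simp
  define w where "w = c / of_real (norm c)"
  have w: "norm w = 1" "c = of_real (norm c) * w" using c0 by (simp_all add: w_def norm_divide)
  define B where "B = (\<Sum>p\<in>I. norm (\<alpha> * v p)) + 1"
  have B: "B > 0" unfolding B_def by (intro add_nonneg_pos sum_nonneg) auto
  \<comment> \<open>The least nonzero modulus in \<open>f 0\<close>, capped at 1 so that
    \<open>Min\<close> ranges over a nonempty set.\<close>
  define \<delta> where "\<delta> = Min (insert 1 ((\<lambda>p. \<bar>f 0 p\<bar>) ` {p \<in> I. f 0 p \<noteq> 0}))"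
  have \<delta>: "\<delta> > 0" "\<And>p. p \<in> I \<Longrightarrow> f 0 p \<noteq> 0 \<Longrightarrow> \<delta> \<le> \<bar>f 0 p\<bar>"
    unfolding \<delta>_def using fin by (auto simp: Min_gr_iff)
  obtain k where k: "k \<ge> 1" "norm (w ^ k - 1) < \<delta> / B"
    using unit_complex_recurrence[OF w(1)] \<delta>(1) B by (metis divide_pos_pos)
  have near: "(f 0 p > 0 \<longrightarrow> inverse (norm c ^ k) * f k p > 0) \<and> (f 0 p < 0 \<longrightarrow> inverse (norm c ^ k) * f k p < 0)"
    if p: "p \<in> I" for p
  proof (cases "f 0 p = 0")
    case False
    have "c ^ k = of_real (norm c ^ k) * w ^ k" by (subst w(2)) (simp add: power_mult_distrib)
    then have "f k p = Re (of_real (norm c ^ k) * (\<alpha> * w ^ k * v p))" by (simp only: f_def mult_ac)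
    then have eq: "inverse (norm c ^ k) * f k p = Re (\<alpha> * w ^ k * v p)" using c0 by simp
    have "inverse (norm c ^ k) * f k p - f 0 p = Re (\<alpha> * v p * (w ^ k - 1))"
      unfolding eq by (simp add: f_def algebra_simps)
    then have "\<bar>inverse (norm c ^ k) * f k p - f 0 p\<bar> \<le> norm (\<alpha> * v p) * norm (w ^ k - 1)"
      by (metis abs_Re_le_cmod norm_mult)
    also have "norm (\<alpha> * v p) \<le> B" 
      using member_le_sum[of p I "\<lambda>p. norm (\<alpha> * v p)"] p fin by (simp add: B_def)
    then have "norm (\<alpha> * v p) * norm (w ^ k - 1) \<le> B * norm (w ^ k - 1)" by (intro mult_right_mono) auto
    also have "\<dots> < \<delta>" using k(2) B by (simp add: field_simps)
    also have "\<delta> \<le> \<bar>f 0 p\<bar>" by (rule \<delta>(2)[OF p False])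
    finally show ?thesis by linarith
  qed simp
  have "strictly_alternates I (f 1) (Suc r)" if "strictly_alternates I (f 1) r" for r
  proof -
    have "weakly_alternates I (f 1) (Suc r)" by (rule weakly_alternates_extend_zero[OF that q fq])
    then have "strictly_alternates I (f 0) (Suc r)" using step[of 0] by simp
    then have "strictly_alternates I (\<lambda>p. inverse (norm c ^ k) * f k p) (Suc r)"
      by (rule strictly_alternates_sign) (rule near)
    then have "strictly_alternates I (f k) (Suc r)"
      by (rule strictly_alternates_scale[where c = "norm c ^ k"]) (use c0 in auto)
    then show ?thesis using descend[of 1 "k - 1"] k(1) by simp
  qed
  then show False by (rule no_unbounded_alternation[OF nz])
qed

text \<open>Reduction to the real case: \<open>c\<close> is real, and \<open>h\<close> scaled to 1
  at \<open>q\<close> is real since its imaginary part would be an eigenvector vanishing at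
  \<open>q\<close>. Real and imaginary parts of \<open>f\<close> are then treated separately. The
  value \<open>b = 0\<close> covers a second eigenvector.\<close>

lemma no_defective_eigenvalue:
  fixes f h :: "nat \<Rightarrow> complex"
  assumes c: "c \<noteq> 0"
    and h: "\<exists>p\<in>I. h p \<noteq> 0" "\<And>j. j \<in> I \<Longrightarrow> (\<Sum>p\<in>I. of_real (K j p) * h p) = c * h j"
    and f: "\<exists>p\<in>I. f p \<noteq> 0" "f q = 0" "\<And>j. j \<in> I \<Longrightarrow> (\<Sum>p\<in>I. of_real (K j p) * f p) = c * f j + b * h j"
  shows False
proof -
  have "Im c = 0" using no_nonreal_eigenvector[OF h] by blast
  then obtain d where d: "c = of_real d" by (metis complex_is_Real_iff Reals_cases)
  have d0: "d \<noteq> 0" using c d by simp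
  have Re: "(\<Sum>p\<in>I. K j p * Re (x p)) = Re (\<Sum>p\<in>I. of_real (K j p) * x p)"
    and Im: "(\<Sum>p\<in>I. K j p * Im (x p)) = Im (\<Sum>p\<in>I. of_real (K j p) * x p)" for j and x :: "nat \<Rightarrow> complex"
    by simp_all
  have hq: "h q \<noteq> 0"
  proof
    assume hq: "h q = 0"
    have "\<not> (\<exists>p\<in>I. Re (h p) \<noteq> 0)"
      using real_eigenvector_last_nonzero[of "\<lambda>p. Re (h p)" d] hq d0 h(2) unfolding Re by (auto simp: d)
    moreover have "\<not> (\<exists>p\<in>I. Im (h p) \<noteq> 0)"
      using real_eigenvector_last_nonzero[of "\<lambda>p. Im (h p)" d] hq d0 h(2) unfolding Im by (auto simp: d)
    ultimately show False using h(1) by (auto simp: complex_eq_iff)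
  qed
  define h1 where "h1 p = h p / h q" for p
  have h1: "(\<Sum>p\<in>I. of_real (K j p) * h1 p) = c * h1 j" if "j \<in> I" for j
    using h(2)[OF that] by (simp add: h1_def sum_divide_distrib[symmetric])
  have Imh1: "Im (h1 p) = 0" if "p \<in> I" for p
  proof (rule ccontr)
    assume "Im (h1 p) \<noteq> 0"
    then have "Im (h1 q) \<noteq> 0"
      using that by (intro real_eigenvector_last_nonzero[OF _ d0]) (auto simp: Im h1 d)
    then show False using hq by (simp add: h1_def)
  qed
  define \<beta> where "\<beta> = b * h q"
  have f1: "(\<Sum>p\<in>I. of_real (K j p) * f p) = c * f j + \<beta> * h1 j" if "j \<in> I" for j
    using f(3)[OF that] hq by (simp add: \<beta>_def h1_def)
  define g where "g = (\<lambda>p. Re (h1 p))"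
  have g: "\<exists>p\<in>I. g p \<noteq> 0" "\<And>j. j \<in> I \<Longrightarrow> (\<Sum>p\<in>I. K j p * g p) = d * g j"
    using q(1) hq by (auto simp: g_def Re h1 d h1_def[of q] intro!: bexI[of _ q])
  have contra: False if "\<exists>p\<in>I. x p \<noteq> 0" "x q = 0" "\<And>j. j \<in> I \<Longrightarrow> (\<Sum>p\<in>I. K j p * x p) = d * x j + e * g j" for x e
  proof (cases "e = 0")
    case True
    then show False using real_eigenvector_last_nonzero[of x d] that d0 by simp
  next
    case False
    then show False using no_real_jordan_block[OF g(1) d0 g(2) that(2,3)] by blast
  qed
  have "\<not> (\<exists>p\<in>I. Re (f p) \<noteq> 0)"
    using contra[of "\<lambda>p. Re (f p)" "Re \<beta>"] f(2) f1 Imh1 unfolding Re by (auto simp: d g_def)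
  moreover have "\<not> (\<exists>p\<in>I. Im (f p) \<noteq> 0)"
    using contra[of "\<lambda>p. Im (f p)" "Im \<beta>"] f(2) f1 Imh1 unfolding Im by (auto simp: d g_def)
  ultimately show False using f(1) by (auto simp: complex_eq_iff)
qed

end

subsection \<open>Reduction to an eigenvalue problem\<close>

text \<open>
  Cofactor expansion of \<open>C h = (x - x0) h\<close>, where \<open>C = x + A\<close>, shows that replacing column \<open>q\<close> of \<open>C\<close>
  by the eigenvector \<open>h\<close> gives a determinant that still vanishes at a double root \<open>x0\<close>.
\<close>

lemma double_root_det_defective:
  fixes A :: "nat \<Rightarrow> nat \<Rightarrow> 'a::field_char_0" and N q :: nat
  defines "\<chi> \<equiv> det (mat N N (\<lambda>(i, j). (if i = j then [:0, 1:] else 0) + [:A i j:]))"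
  assumes root: "poly \<chi> x0 = 0" "poly (pderiv \<chi>) x0 = 0" and q: "q < N"
  obtains h f b where "\<exists>p<N. h p \<noteq> 0" "\<And>i. i < N \<Longrightarrow> (\<Sum>p<N. A i p * h p) = - x0 * h i"
    "\<exists>p<N. f p \<noteq> 0" "f q = 0" "\<And>i. i < N \<Longrightarrow> (\<Sum>p<N. A i p * f p) = - x0 * f i + b * h i"
proof -
  define Ce where "Ce i j = (if i = j then [:0, 1:] else 0) + [:A i j:]" for i j
  define C where "C = mat N N (\<lambda>(i, j). Ce i j)"
  have C: "C \<in> carrier_mat N N" by (simp add: C_def)
  have \<chi>: "\<chi> = det C" by (simp add: \<chi>_def C_def Ce_def)
  have app: "(\<Sum>p<N. poly (Ce i p) x * g p) = x * g i + (\<Sum>p<N. A i p * g p)" if "i < N" for i g x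
  proof -
    have "(\<Sum>p<N. poly (Ce i p) x * g p) = (\<Sum>p<N. (if i = p then x * g p else 0) + A i p * g p)"
      by (intro sum.cong) (auto simp: Ce_def algebra_simps)
    then show ?thesis using that by (simp add: sum.distrib)
  qed
  have "det (mat N N (\<lambda>(i, j). poly (Ce i j) x0)) = 0"
    using root(1) unfolding \<chi> C_def poly_det_mat .
  then obtain h where h: "\<exists>p<N. h p \<noteq> 0" "\<And>i. i < N \<Longrightarrow> (\<Sum>p<N. poly (Ce i p) x0 * h p) = 0"
    using det_mat_eq_0_kernel by blast
  have eig: "(\<Sum>p<N. A i p * h p) = - x0 * h i" if "i < N" for i
    using h(2)[OF that] unfolding app[OF that] by (simp add: eq_neg_iff_add_eq_0 add.commute)
  show ?thesis
  proof (cases "h q = 0")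
    case True
    \<comment> \<open>An eigenvector that vanishes at \<open>q\<close> can serve as \<open>f\<close>
      itself.\<close>
    then show ?thesis using that[of h h 0] h(1) eig by simp
  next
    case False
    define D where "D = det (mat N N (\<lambda>(i, j). if j = q then [:h i:] else Ce i j))"
    have col: "(\<Sum>p<N. [:h p:] * Ce i p) = [:- x0, 1:] * [:h i:]" if i: "i < N" for i
    proof (rule poly_eq_poly_eq_iff[THEN iffD1], rule ext)
      fix x
      show "poly (\<Sum>p<N. [:h p:] * Ce i p) x = poly ([:- x0, 1:] * [:h i:]) x"
        using app[OF i, of x h] eig[OF i] by (simp add: poly_sum mult.commute algebra_simps)
    qed
    have D: "D = (\<Sum>i<N. [:h i:] * cofactor C i q)"
      unfolding D_def
    proof (subst laplace_expansion_column[of _ N q])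
      have "cofactor (mat N N (\<lambda>(i, j). if j = q then [:h i:] else Ce i j)) i q = cofactor C i q" for i
        unfolding cofactor_def C_def
        by (intro arg_cong2[where f = "(*)"] arg_cong[where f = det] refl eq_matI)
          (auto simp: mat_delete_def)
      then show "(\<Sum>i<N. mat N N (\<lambda>(i, j). if j = q then [:h i:] else Ce i j) $$ (i, q) *
          cofactor (mat N N (\<lambda>(i, j). if j = q then [:h i:] else Ce i j)) i q) = (\<Sum>i<N. [:h i:] * cofactor C i q)"
        using q by (intro sum.cong) auto
    qed (use q in auto)
    have adj: "(\<Sum>i<N. cofactor C i q * Ce i p) = (if p = q then \<chi> else 0)" if p: "p < N" for p
    proof -
      have "(adj_mat C * C) $$ (q, p) = (det C \<cdot>\<^sub>m 1\<^sub>m N) $$ (q, p)" by (simp only: adj_mat(3)[OF C])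
      moreover have "(adj_mat C * C) $$ (q, p) = (\<Sum>i<N. cofactor C i q * Ce i p)"
        using p q C adj_mat(1)[OF C] by (simp add: times_mat_def scalar_prod_def adj_mat_def C_def atLeast0LessThan)
      ultimately show ?thesis using p q by (simp add: \<chi>)
    qed
    have "[:h q:] * \<chi> = (\<Sum>p<N. [:h p:] * (if p = q then \<chi> else 0))"
      using q by (simp add: if_distrib cong: if_cong)
    also have "\<dots> = (\<Sum>p<N. \<Sum>i<N. cofactor C i q * ([:h p:] * Ce i p))"
      by (intro sum.cong refl) (simp only: mult.left_commute[of _ "[:_:]"] sum_distrib_left[symmetric] adj lessThan_iff)
    also have "\<dots> = (\<Sum>i<N. cofactor C i q * (\<Sum>p<N. [:h p:] * Ce i p))"
      unfolding sum_distrib_left by (rule sum.swap)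
    also have "\<dots> = (\<Sum>i<N. cofactor C i q * ([:- x0, 1:] * [:h i:]))"
      using col by (intro sum.cong) auto
    also have "\<dots> = [:- x0, 1:] * D"
      unfolding D sum_distrib_left by (intro sum.cong refl) (simp only: mult_ac)
    finally have "[:h q:] * \<chi> = [:- x0, 1:] * D" .
    then have "poly (pderiv ([:h q:] * \<chi>)) x0 = poly (pderiv ([:- x0, 1:] * D)) x0" by simp
    \<comment> \<open>The derivative of (x - x0) D at x0 is D(x0), and the other side has a double
      root there.\<close>
    then have "poly D x0 = 0" using root unfolding pderiv_mult poly_add poly_mult by (simp add: pderiv_pCons)
    then have "det (mat N N (\<lambda>(i, j). poly (if j = q then [:h i:] else Ce i j) x0)) = 0"
      unfolding D_def poly_det_mat .
    then obtain g where g: "\<exists>p<N. g p \<noteq> 0"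
        "\<And>i. i < N \<Longrightarrow> (\<Sum>p<N. poly (if p = q then [:h i:] else Ce i p) x0 * g p) = 0"
      using det_mat_eq_0_kernel[of N "\<lambda>i j. poly (if j = q then [:h i:] else Ce i j) x0"] by blast
    \<comment> \<open>Entry \<open>q\<close> of the kernel vector multiplies the inserted column
      \<open>h\<close>; moved to the right-hand side it becomes \<open>b = - g q\<close>.\<close>
    define f where "f = g(q := 0)"
    have f: "(\<Sum>p<N. A i p * f p) = - x0 * f i + (- g q) * h i" if i: "i < N" for i
    proof -
      have "(\<Sum>p<N. poly (if p = q then [:h i:] else Ce i p) x0 * g p) =
          (\<Sum>p<N. poly (Ce i p) x0 * f p + (if p = q then g q * h i else 0))"
        by (intro sum.cong) (auto simp: f_def)
      also have "\<dots> = (\<Sum>p<N. poly (Ce i p) x0 * f p) + g q * h i" using q by (simp add: sum.distrib)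
      finally have "x0 * f i + (\<Sum>p<N. A i p * f p) + g q * h i = 0"
        using g(2)[OF i] unfolding app[OF i] by simp
      then show ?thesis by (simp add: algebra_simps eq_neg_iff_add_eq_0)
    qed
    have "\<exists>p<N. f p \<noteq> 0"
    proof (rule ccontr)
      assume "\<not> (\<exists>p<N. f p \<noteq> 0)"
      then have f0: "\<And>p. p < N \<Longrightarrow> f p = 0" by blast
      then have "g q * h q = 0" using f[OF q] q by simp
      then have "g q = 0" using False by simp
      then show False using g(1) f0 by (metis f_def fun_upd_apply)
    qed
    then show ?thesis using that[of h f "- g q"] h(1) eig f by (simp add: f_def)
  qed
qed

section \<open>Factoring the Wronskian through falling factorials\<close>

lemma det_mat_scale:
  fixes r c :: "nat \<Rightarrow> 'a::comm_ring_1"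
  shows "det (mat n n (\<lambda>(i, j). r i * c j * f i j)) = (\<Prod>i<n. r i) * (\<Prod>j<n. c j) * det (mat n n (\<lambda>(i, j). f i j))"
proof -
  have "signof p * (\<Prod>i = 0..<n. mat n n (\<lambda>(i, j). r i * c j * f i j) $$ (i, p i)) =
      (\<Prod>i<n. r i) * (\<Prod>j<n. c j) * (signof p * (\<Prod>i = 0..<n. mat n n (\<lambda>(i, j). f i j) $$ (i, p i)))"
    if p: "p permutes {0..<n}" for p
  proof -
    have pi: "p i < n" if "i < n" for i using p that permutes_in_image[of p "{0..<n}" i] by auto
    have "(\<Prod>i = 0..<n. mat n n (\<lambda>(i, j). r i * c j * f i j) $$ (i, p i)) = (\<Prod>i = 0..<n. r i * c (p i) * f i (p i))"
      using pi by (intro prod.cong) auto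
    also have "\<dots> = (\<Prod>i = 0..<n. r i) * (\<Prod>i = 0..<n. c (p i)) * (\<Prod>i = 0..<n. f i (p i))"
      by (simp only: prod.distrib)
    also have "(\<Prod>i = 0..<n. c (p i)) = (\<Prod>i = 0..<n. c i)"
      using prod.permute[OF p, of c] by (simp add: o_def)
    also have "(\<Prod>i = 0..<n. f i (p i)) = (\<Prod>i = 0..<n. mat n n (\<lambda>(i, j). f i j) $$ (i, p i))"
      using pi by (intro prod.cong) auto
    finally show ?thesis by (simp add: atLeast0LessThan mult_ac)
  qed
  then show ?thesis
    by (simp add: det_def'[of _ n] sum_distrib_left)
qed

text \<open>Falling factorials as polynomials in the exponent, so that they can be interpolated: the
  value at \<open>n\<close> is the factor in the \<open>i\<close>-th derivative of z^n, and it is 0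
  for n < i.\<close>

definition ffact_poly :: "nat \<Rightarrow> 'a::comm_ring_1 poly" where
  "ffact_poly i = (\<Prod>t<i. [:- of_nat t, 1:])"

lemma poly_ffact_poly_of_nat:
  "poly (ffact_poly i) (of_nat n) = (if i \<le> n then fact n / fact (n - i) else 0 :: 'a::field_char_0)"
proof (cases "i \<le> n")
  case True
  then show ?thesis
  proof (induction i)
    case (Suc i)
    then have "n - i = Suc (n - Suc i)" by simp
    then have "fact (n - i) = of_nat (n - i) * (fact (n - Suc i) :: 'a)" by (metis fact_Suc)
    moreover have "poly (ffact_poly (Suc i)) (of_nat n) = poly (ffact_poly i) (of_nat n) * (of_nat (n - i) :: 'a)"
      using Suc.prems by (simp add: ffact_poly_def of_nat_diff algebra_simps)
    moreover have "of_nat (n - i) \<noteq> (0 :: 'a)" using Suc.prems by simp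
    ultimately show ?case using Suc by (simp add: divide_simps)
  qed (simp add: ffact_poly_def)
qed (auto simp: ffact_poly_def poly_prod)

lemma degree_ffact_poly: "degree (ffact_poly i :: 'a::idom poly) = i"
  by (simp add: ffact_poly_def degree_prod_linear)

text \<open>A Vandermonde determinant in another basis: a kernel vector is a polynomial of degree
  below \<open>N\<close> with \<open>N\<close> roots, and evaluation at 0, 1, ... peels off its
  coefficients.\<close>

lemma det_ffact_nonzero:
  fixes u :: "nat \<Rightarrow> 'a::field_char_0"
  assumes "inj_on u {..<N}"
  shows "det (mat N N (\<lambda>(p, i). poly (ffact_poly i) (u p))) \<noteq> 0"
proof
  assume "det (mat N N (\<lambda>(p, i). poly (ffact_poly i) (u p))) = 0"
  then obtain w where w: "\<exists>i<N. w i \<noteq> 0" "\<And>p. p < N \<Longrightarrow> (\<Sum>i<N. poly (ffact_poly i) (u p) * w i) = 0"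
    using det_mat_eq_0_kernel[of N "\<lambda>p i. poly (ffact_poly i) (u p)"] by blast
  define Q where "Q = (\<Sum>i<N. Polynomial.smult (w i) (ffact_poly i))"
  have "N > 0" using w(1) by auto
  then have "degree Q \<le> N - 1" unfolding Q_def
    by (intro degree_sum_le) (auto intro!: order.trans[OF degree_smult_le] simp: degree_ffact_poly)
  then have deg: "degree Q < N" using \<open>N > 0\<close> by simp
  have "Q = Polynomial.smult (coeff Q N) (\<Prod>i<N. [:- u i, 1:])"
    by (rule eq_prod_linear_of_roots[OF _ assms]) (use deg w(2) in \<open>auto simp: Q_def poly_sum mult.commute\<close>)
  then have Q: "Q = 0" using deg by (simp add: coeff_eq_0)
  have "w t = 0" if "t < N" for t
    using that
  proof (induction t rule: less_induct)
    case (less t)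
    have "0 = poly Q (of_nat t)" using Q by simp
    also have "\<dots> = (\<Sum>i<N. if i = t then w t * fact t else 0)"
      unfolding Q_def poly_sum
      using less.IH less.prems by (intro sum.cong refl) (auto simp: poly_ffact_poly_of_nat not_le)
    finally show ?case using less.prems by simp
  qed
  then show False using w(1) by blast
qed

lemma pgen_less_double:
  assumes "n < 2 * m"
  shows "poly (pgen m n) z = z ^ n / fact n + (if m \<le> n then z ^ (n - m) / fact (n - m) else 0)"
proof (cases "m \<le> n")
  case False
  then show ?thesis by (simp add: pgen_eq_monom poly_monom)
next
  case True
  then have "n = n - m + m * 1" "n - m < m" using assms by auto
  then have "pgen m n = (\<Sum>i\<le>1. monom (1 / (fact (n - m + m * i) * fact (1 - i))) (n - m + m * i))"
    using pgen_eq_sum_monom[of m "n - m" 1] by simp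
  then show ?thesis using True by (simp add: poly_monom)
qed

text \<open>The factor z^(m + i) removes \<open>i\<close> from all exponents, leaving it only in the
  falling factorials; a term lost by differentiation has falling factorial 0.\<close>

lemma poly_deriv_pgen_less_double:
  fixes z :: complex
  assumes "n < 2 * m" "m \<ge> 1" "z \<noteq> 0"
  shows "z ^ (m + i) * poly ((pderiv ^^ i) (pgen m n)) z =
    z ^ n / fact n * (z ^ m * poly (ffact_poly i) (of_nat n) +
      (if m \<le> n then fact n / fact (n - m) * poly (ffact_poly i) (of_nat (n - m)) else 0))"
proof (cases "i \<le> n")
  case False
  then show ?thesis using assms by (auto simp: pderiv_funpow_pgen poly_ffact_poly_of_nat simp del: of_nat_diff)
next
  case True
  have p: "poly ((pderiv ^^ i) (pgen m n)) z = z ^ (n - i) / fact (n - i) +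
      (if m \<le> n - i then z ^ (n - i - m) / fact (n - i - m) else 0)"
    using True assms pgen_less_double[of "n - i" m z] by (simp add: pderiv_funpow_pgen)
  have a: "z ^ (m + i) * (z ^ (n - i) / fact (n - i)) = z ^ n / fact n * (z ^ m * poly (ffact_poly i) (of_nat n))"
    using True by (simp add: poly_ffact_poly_of_nat) (simp add: add.commute flip: power_add)
  have b: "z ^ (m + i) * (if m \<le> n - i then z ^ (n - i - m) / fact (n - i - m) else 0) =
      z ^ n / fact n * (if m \<le> n then fact n / fact (n - m) * poly (ffact_poly i) (of_nat (n - m)) else 0)"
  proof (cases "m \<le> n - i")
    case True
    then have "i \<le> n - m" "m \<le> n" "n - i - m = n - m - i" "m + i + (n - m - i) = n" using \<open>i \<le> n\<close> by auto
    then show ?thesis using True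
      by (simp add: poly_ffact_poly_of_nat del: of_nat_diff diff_diff_left) (simp flip: power_add)
  next
    case False
    then show ?thesis using \<open>i \<le> n\<close> by (auto simp: poly_ffact_poly_of_nat simp del: of_nat_diff)
  qed
  show ?thesis unfolding p distrib_left a b ..
qed

text \<open>Lagrange interpolation at the nodes \<open>n p\<close> is exact on the falling
  factorials of degree below \<open>N\<close>, so their values at \<open>n j - m\<close> are
  combinations of values at nodes. The matrix thus factors as (z^m + A) \<open>\<Phi>\<close> with
  \<open>\<Phi>\<close> invertible.\<close>

lemma wronskian_pgen_eq_det:
  fixes n :: "nat \<Rightarrow> nat"
  assumes m: "m \<ge> 1" and n: "inj_on n {..<N}" "\<And>j. j < N \<Longrightarrow> n j < 2 * m"
    and fs: "length fs = N" "\<And>j. j < N \<Longrightarrow> fs ! j = pgen m (n j)"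
  defines "b \<equiv> \<lambda>j. if m \<le> n j then fact (n j) / fact (n j - m) else 0 :: complex"
  defines "A \<equiv> \<lambda>j p. b j * (\<Prod>s\<in>{..<N} - {p}. (of_nat (n j - m) - of_nat (n s)) / (of_nat (n p) - of_nat (n s)))"
  shows "\<exists>C a. C \<noteq> 0 \<and> wronskian fs * monom 1 (\<Sum>i<N. m + i) = Polynomial.smult C (monom 1 a *
    pcompose (det (mat N N (\<lambda>(i, j). (if i = j then [:0, 1:] else 0) + [:A i j:]))) (monom 1 m))"
proof -
  define \<chi> where "\<chi> = det (mat N N (\<lambda>(i, j). (if i = j then [:0, 1:] else 0) + [:A i j:]))"
  define \<Phi> where "\<Phi> = mat N N (\<lambda>(p, i). poly (ffact_poly i) (of_nat (n p)) :: complex)"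
  define C where "C = (\<Prod>j<N. 1 / fact (n j)) * det \<Phi>"
  have inj: "inj_on (\<lambda>j. of_nat (n j) :: complex) {..<N}" using n(1) by (auto simp: inj_on_def)
  have "C \<noteq> 0" using det_ffact_nonzero[OF inj] by (simp add: C_def \<Phi>_def)
  moreover have eq: "poly (wronskian fs * monom 1 (\<Sum>i<N. m + i)) z =
      poly (Polynomial.smult C (monom 1 (\<Sum>j<N. n j) * pcompose \<chi> (monom 1 m))) z" if z: "z \<noteq> 0" for z
  proof -
    define M where "M = mat N N (\<lambda>(i, j). (if i = j then z ^ m else 0) + A i j)"
    have cM: "M \<in> carrier_mat N N" "\<Phi> \<in> carrier_mat N N" by (simp_all add: M_def \<Phi>_def)
    have lag: "z ^ m * poly (ffact_poly i) (of_nat (n j)) + b j * poly (ffact_poly i) (of_nat (n j - m)) =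
        (\<Sum>p<N. ((if j = p then z ^ m else 0) + A j p) * poly (ffact_poly i) (of_nat (n p)))" if "i < N" "j < N" for i j
    proof -
      have "poly (ffact_poly i) (of_nat (n j - m) :: complex) = (\<Sum>p<N. poly (ffact_poly i) (of_nat (n p)) *
          (\<Prod>s\<in>{..<N} - {p}. (of_nat (n j - m) - of_nat (n s)) / (of_nat (n p) - of_nat (n s))))"
        using that(1) inj
        by (subst lagrange_interpolation_poly[of "{..<N}" "\<lambda>j. of_nat (n j)" "ffact_poly i"])
          (simp_all add: degree_ffact_poly poly_sum poly_prod prod_dividef)
      then have "b j * poly (ffact_poly i) (of_nat (n j - m)) = (\<Sum>p<N. A j p * poly (ffact_poly i) (of_nat (n p)))"
        by (simp add: A_def sum_distrib_left mult_ac)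
      moreover have "z ^ m * poly (ffact_poly i) (of_nat (n j)) = (\<Sum>p<N. if j = p then z ^ m * poly (ffact_poly i) (of_nat (n p)) else 0)"
        using that(2) by simp
      ultimately show ?thesis
        by (simp add: distrib_right sum.distrib if_distrib[of "\<lambda>x. x * _"] cong: if_cong)
    qed
    have M\<Phi>: "M * \<Phi> = mat N N (\<lambda>(j, i). z ^ m * poly (ffact_poly i) (of_nat (n j)) + b j * poly (ffact_poly i) (of_nat (n j - m)))"
      using lag by (intro eq_matI) (simp_all add: M_def \<Phi>_def scalar_prod_def atLeast0LessThan)
    have "(\<Prod>i<N. z ^ (m + i)) * poly (wronskian fs) z =
        det (mat N N (\<lambda>(i, j). z ^ (m + i) * 1 * poly ((pderiv ^^ i) (fs ! j)) z))"
      unfolding wronskian_def fs(1) poly_det_mat by (subst det_mat_scale) simp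
    also have "\<dots> = det (mat N N (\<lambda>(i, j). 1 * (z ^ n j / fact (n j)) *
        (z ^ m * poly (ffact_poly i) (of_nat (n j)) + b j * poly (ffact_poly i) (of_nat (n j - m)))))"
    proof (intro arg_cong[where f = det] cong_mat refl)
      fix i j assume "i < N" "j < N"
      then show "(case (i, j) of (i, j) \<Rightarrow> z ^ (m + i) * 1 * poly ((pderiv ^^ i) (fs ! j)) z) =
          (case (i, j) of (i, j) \<Rightarrow> 1 * (z ^ n j / fact (n j)) *
            (z ^ m * poly (ffact_poly i) (of_nat (n j)) + b j * poly (ffact_poly i) (of_nat (n j - m))))"
        using poly_deriv_pgen_less_double[OF n(2) m z, of j i] fs(2) by (simp add: b_def)
    qed
    also have "\<dots> = (\<Prod>j<N. z ^ n j / fact (n j)) * det (transpose_mat (M * \<Phi>))"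
    proof -
      have "transpose_mat (M * \<Phi>) = mat N N (\<lambda>(i, j). z ^ m * poly (ffact_poly i) (of_nat (n j)) + b j * poly (ffact_poly i) (of_nat (n j - m)))"
        unfolding M\<Phi> by (intro eq_matI) auto
      then show ?thesis by (subst det_mat_scale) simp
    qed
    also have "det (transpose_mat (M * \<Phi>)) = det M * det \<Phi>"
      using det_transpose[OF mult_carrier_mat[OF cM]] det_mult[OF cM] by simp
    also have "det M = poly \<chi> (z ^ m)"
      unfolding \<chi>_def poly_det_mat M_def by (intro arg_cong[where f = det] cong_mat) auto
    also have "(\<Prod>j<N. z ^ n j / fact (n j)) = z ^ (\<Sum>j<N. n j) * (\<Prod>j<N. 1 / fact (n j))"
      by (simp add: power_sum prod_dividef)
    also have "(\<Prod>i<N. z ^ (m + i)) = z ^ (\<Sum>i<N. m + i)"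
      by (simp only: power_sum)
    finally show ?thesis
      by (simp only: C_def poly_mult poly_smult poly_monom poly_pcompose mult_1 mult_ac)
  qed
  \<comment> \<open>The pointwise identity is available for nonzero z; an extra factor z makes it
    hold everywhere and is then cancelled.\<close>
  have "[:0, 1:] * (wronskian fs * monom 1 (\<Sum>i<N. m + i)) = [:0, 1:] * Polynomial.smult C (monom 1 (\<Sum>j<N. n j) * pcompose \<chi> (monom 1 m))"
  proof (rule poly_eq_poly_eq_iff[THEN iffD1], rule ext)
    fix z
    show "poly ([:0, 1:] * (wronskian fs * monom 1 (\<Sum>i<N. m + i))) z =
      poly ([:0, 1:] * Polynomial.smult C (monom 1 (\<Sum>j<N. n j) * pcompose \<chi> (monom 1 m))) z"
      by (cases "z = 0") (simp, simp only: poly_mult[of "[:0, 1:]"] eq not_False_eq_True)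
  qed
  then have "wronskian fs * monom 1 (\<Sum>i<N. m + i) = Polynomial.smult C (monom 1 (\<Sum>j<N. n j) * pcompose \<chi> (monom 1 m))"
    by (subst (asm) mult_cancel_left) simp
  ultimately show ?thesis unfolding \<chi>_def by blast
qed

section \<open>Two-term polynomials: no multiple nonzero roots\<close>

lemma prod_lagrange_at_node:
  fixes u :: "nat \<Rightarrow> 'a::field"
  assumes "inj_on u {..<N}" "p < N" "r < N"
  shows "(\<Prod>s\<in>{..<N} - {p}. (u r - u s) / (u p - u s)) = (if p = r then 1 else 0)"
proof (cases "p = r")
  case True
  have "u r - u s \<noteq> 0" if "s \<in> {..<N} - {r}" for s using assms(1,3) that by (auto simp: inj_on_def)
  then show ?thesis using True by (simp add: prod.neutral)
next
  case False
  then show ?thesis using assms by (auto intro!: prod_zero)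
qed

text \<open>With m = k e, a shifted node n_j - m is the node n_(j - e), so row \<open>j\<close>
  reads only entry \<open>j - e\<close>; as e >= 1, the entries vanish one after another.\<close>

lemma shifted_eigenvector_eq_0:
  fixes h :: "nat \<Rightarrow> complex"
  assumes "k \<ge> 1" "l < k" "k dvd m" "m \<ge> 1" "c \<noteq> 0"
  defines "n \<equiv> \<lambda>j. l + j * k"
  defines "b \<equiv> \<lambda>j. if m \<le> n j then fact (n j) / fact (n j - m) else 0 :: complex"
  assumes h: "\<And>j. j < N \<Longrightarrow> (\<Sum>p<N. (b j * (\<Prod>s\<in>{..<N} - {p}. (of_nat (n j - m) - of_nat (n s)) / (of_nat (n p) - of_nat (n s)))) * h p) = c * h j"
  shows "j < N \<Longrightarrow> h j = 0"
proof (induction j rule: less_induct)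
  case (less j)
  have inj: "inj_on (\<lambda>j. of_nat (n j) :: complex) {..<N}" using assms(1) by (auto simp: inj_on_def n_def simp del: of_nat_add of_nat_mult)
  have "c * h j = 0"
  proof (cases "m \<le> n j")
    case False
    then show ?thesis using h[OF less.prems] by (simp add: b_def)
  next
    case True
    obtain e where e: "m = k * e" using assms(3) by blast
    have "e \<le> j"
    proof (rule ccontr)
      assume "\<not> e \<le> j"
      then have "k * Suc j \<le> k * e" by (intro mult_le_mono) auto
      then show False using True assms(2) e by (simp add: n_def mult.commute)
    qed
    have "e \<ge> 1" using e assms(4) by (cases e) auto
    have u: "n j - m = n (j - e)" using \<open>e \<le> j\<close> e by (simp add: n_def algebra_simps diff_mult_distrib2)
    have "(\<Sum>p<N. (b j * (\<Prod>s\<in>{..<N} - {p}. (of_nat (n j - m) - of_nat (n s)) / (of_nat (n p) - of_nat (n s)))) * h p) =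
      (\<Sum>p<N. (if p = j - e then b j * h p else 0))"
      unfolding u using prod_lagrange_at_node[OF inj, of _ "j - e"] less.prems by (intro sum.cong) auto
    also have "\<dots> = b j * h (j - e)" using less.prems by simp
    also have "\<dots> = 0" using less.IH[of "j - e"] less.prems \<open>e \<ge> 1\<close> \<open>e \<le> j\<close> by simp
    finally show ?thesis using h[OF less.prems] by simp
  qed
  then show ?case using assms(5) by simp
qed

text \<open>
  If \<open>k\<close> does not divide \<open>m\<close>, exactly the nodes \<open>n s\<close> with \<open>s \<ge> j - m div k\<close> lie above \<open>n j - m\<close>.
\<close>

lemma node_product_sign:
  fixes k l m :: nat
  assumes "l < k" "\<not> k dvd m" "m \<le> l + j * k" "j < N"
  shows "(-1) ^ (N - (j - m div k)) * (\<Prod>s<N. real (l + j * k - m) - real (l + s * k)) > 0" "m div k \<le> j"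
proof -
  define M where "M = m div k"
  have m: "m = k * M + m mod k" "0 < m mod k" "m mod k < k"
    using assms(1,2) by (simp_all add: M_def mod_greater_zero_iff_not_dvd)
  have "k * M < k * Suc j" using m(1) assms(1,3) by (simp add: mult.commute)
  then have "M < Suc j" unfolding mult_less_cancel1 by simp
  then have M: "M \<le> j" by simp
  then show "m div k \<le> j" by (simp add: M_def)
  have lower: "real (l + j * k - m) - real (l + s * k) > 0" if s: "s < j - M" for s
  proof -
    have "s + M + 1 \<le> j" using s by simp
    then have "(s + M + 1) * k \<le> j * k" by (intro mult_le_mono1)
    then have "l + s * k + m < l + j * k" using m by (simp add: algebra_simps)
    then have "l + s * k < l + j * k - m" by linarith
    then show ?thesis by (simp only: diff_gt_0_iff_gt of_nat_less_iff)
  qed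
  have upper: "real (l + s * k) - real (l + j * k - m) > 0" if s: "j - M \<le> s" for s
  proof -
    have "j * k \<le> (s + M) * k" using s by (intro mult_le_mono1) simp
    then have "l + j * k < l + s * k + m" using m by (simp add: algebra_simps)
    then have "l + j * k - m < l + s * k" using assms(3) by linarith
    then show ?thesis by (simp only: diff_gt_0_iff_gt of_nat_less_iff)
  qed
  have split: "{..<N} = {..<j - M} \<union> {j - M..<N}" using assms(4) by auto
  have "(\<Prod>s<N. real (l + j * k - m) - real (l + s * k)) = (\<Prod>s<j - M. real (l + j * k - m) - real (l + s * k)) *
      (\<Prod>s\<in>{j - M..<N}. (-1) * (real (l + s * k) - real (l + j * k - m)))"
    unfolding split by (subst prod.union_disjoint) auto
  also have "(\<Prod>s\<in>{j - M..<N}. (-1) * (real (l + s * k) - real (l + j * k - m))) =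
      (-1) ^ (N - (j - M)) * (\<Prod>s\<in>{j - M..<N}. real (l + s * k) - real (l + j * k - m))"
    unfolding prod.distrib by simp
  finally have "(-1) ^ (N - (j - M)) * (\<Prod>s<N. real (l + j * k - m) - real (l + s * k)) =
      ((-1) ^ (N - (j - M)) * (-1) ^ (N - (j - M))) * ((\<Prod>s<j - M. real (l + j * k - m) - real (l + s * k)) *
      (\<Prod>s\<in>{j - M..<N}. real (l + s * k) - real (l + j * k - m)))"
    by (simp only: mult_ac)
  also have "\<dots> = (\<Prod>s<j - M. real (l + j * k - m) - real (l + s * k)) *
      (\<Prod>s\<in>{j - M..<N}. real (l + s * k) - real (l + j * k - m))"
    by (simp flip: power_mult_distrib)
  also have "\<dots> > 0" using lower upper by (intro mult_pos_pos prod_pos) auto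
  finally show "(-1) ^ (N - (j - m div k)) * (\<Prod>s<N. real (l + j * k - m) - real (l + s * k)) > 0"
    by (simp add: M_def)
qed

lemma wronskian_double_root_short:
  fixes z :: complex
  assumes k: "k \<ge> 1" "l < k" and m: "m \<ge> 1" and z: "z \<noteq> 0"
    and short: "\<And>j. j < N \<Longrightarrow> l + j * k < 2 * m"
    and fs: "length fs = N" "\<And>j. j < N \<Longrightarrow> fs ! j = pgen m (l + j * k)"
    and W: "poly (wronskian fs) z = 0" "poly (pderiv (wronskian fs)) z = 0"
  shows False
proof -
  define n where "n j = l + j * k" for j
  define b where "b j = (if m \<le> n j then fact (n j) / fact (n j - m) else 0 :: real)" for j
  define B where "B j p = b j * (\<Prod>s\<in>{..<N} - {p}. (real (n j - m) - real (n s)) / (real (n p) - real (n s)))" for j p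
  define A where "A j p = (if m \<le> n j then fact (n j) / fact (n j - m) else 0 :: complex) *
    (\<Prod>s\<in>{..<N} - {p}. (of_nat (n j - m) - of_nat (n s)) / (of_nat (n p) - of_nat (n s)))" for j p
  have AB: "A j p = of_real (B j p)" for j p by (simp add: A_def B_def b_def)
  have strict: "strict_mono n" using k by (auto simp: strict_mono_def n_def)
  have "inj_on n {..<N}" using strict by (auto simp: inj_on_def strict_mono_eq)
  from wronskian_pgen_eq_det[OF m this, of fs] short fs obtain C a where C: "C \<noteq> 0"
    "wronskian fs * monom 1 (\<Sum>i<N. m + i) = Polynomial.smult C (monom 1 a *
      pcompose (det (mat N N (\<lambda>(i, j). (if i = j then [:0, 1:] else 0) + [:A i j:]))) (monom 1 m))"
    by (auto simp: n_def A_def)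
  note root = double_root_pcompose_monom[OF C(2,1) z m W]
  define c where "c = - (z ^ m)"
  have c: "c \<noteq> 0" using z by (simp add: c_def)
  have N: "N > 0" 
  proof (rule ccontr)
    assume "\<not> N > 0"
    then show False using root(1) by simp
  qed
  define q where "q = N - 1"
  have "q < N" using N by (simp add: q_def)
  obtain h f \<beta> where h: "\<exists>p<N. h p \<noteq> 0" "\<And>i. i < N \<Longrightarrow> (\<Sum>p<N. A i p * h p) = c * h i"
    and f: "\<exists>p<N. f p \<noteq> 0" "f q = 0" "\<And>i. i < N \<Longrightarrow> (\<Sum>p<N. A i p * f p) = c * f i + \<beta> * h i"
    unfolding c_def using double_root_det_defective[OF root \<open>q < N\<close>] by blast
  show False
  proof (cases "k dvd m")
    case True
    have "h j = 0" if "j < N" for j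
      by (rule shifted_eigenvector_eq_0[OF k True m c h(2)[unfolded A_def n_def] that])
    then show False using h(1) by blast
  next
    case False
    \<comment> \<open>Rows outside \<open>I\<close> are zero and \<open>c\<close> is not, so
      \<open>h\<close>, and then \<open>f\<close>, is supported in \<open>I\<close>.\<close>
    define I where "I = {j. j < N \<and> m \<le> n j}"
    have h0: "h j = 0" if "j < N" "j \<notin> I" for j
      using h(2)[of j] that c by (simp add: A_def I_def)
    have f0: "f j = 0" if "j < N" "j \<notin> I" for j
      using f(3)[of j] h0[OF that] that c by (simp add: A_def I_def)
    have fin: "finite I" by (simp add: I_def)
    have hI: "\<exists>p\<in>I. h p \<noteq> 0" and fI: "\<exists>p\<in>I. f p \<noteq> 0" using h(1) f(1) h0 f0 by blast+
    have q: "q \<in> I" "\<And>p. p \<in> I \<Longrightarrow> p \<le> q"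
    proof -
      obtain p where p: "p \<in> I" using hI by blast
      then have "p \<le> q" unfolding I_def q_def by simp linarith
      then have "n p \<le> n q" using strict by (simp add: strict_mono_less_eq)
      then show "q \<in> I" using p N by (simp add: I_def q_def)
    qed (auto simp: I_def q_def)
    define M where "M = m div k"
    define \<omega> where "\<omega> j = (\<Prod>s<N. real (n j - m) - real (n s))" for j
    define \<omega>' where "\<omega>' p = (\<Prod>s\<in>{..<N} - {p}. real (n p) - real (n s))" for p
    define a where "a j = b j * ((-1) ^ (N - (j - M)) * \<omega> j)" for j
    define d where "d p = 1 / ((-1) ^ (N - Suc p) * \<omega>' p)" for p
    define K where "K j p = a j * d p / (real (n p) - real (n j - m))" for j p
    have \<omega>: "(-1) ^ (N - (j - M)) * \<omega> j > 0" "M \<le> j" if "j \<in> I" for j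
      using node_product_sign[OF k(2) False, of j N] that by (simp_all add: I_def n_def \<omega>_def M_def)
    have smr: "strict_mono_on {..<N} (\<lambda>j. real (n j))" using strict by (auto simp: strict_mono_on_def strict_mono_def)
    have \<omega>': "(-1) ^ (N - Suc p) * \<omega>' p > 0" if "p \<in> I" for p
      using prod_diff_sign_pos[OF smr, of p] that by (simp add: I_def \<omega>'_def)
    have apos: "a j > 0" if "j \<in> I" for j
      unfolding a_def by (rule mult_pos_pos[OF _ \<omega>(1)[OF that]]) (use that in \<open>simp add: b_def I_def\<close>)
    have dpos: "d p > 0" if "p \<in> I" for p using \<omega>'[OF that] by (simp add: d_def)
    \<comment> \<open>The bound \<open>n j < 2 * m\<close> puts every shifted node below
      \<open>m\<close> and thus below every node of \<open>I\<close>, so the Cauchy denominators are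
      positive.\<close>
    have less: "real (n j - m) < real (n p)" if "p \<in> I" "j \<in> I" for p j
    proof -
      have "n j < 2 * m" "m \<le> n p" "m \<le> n j" using that short[of j] by (auto simp: I_def n_def)
      then show ?thesis unfolding of_nat_less_iff by linarith
    qed
    \<comment> \<open>The signs come from N - (j - M) nodes above \<open>n j - m\<close>, N - 1 - p
      nodes above \<open>n p\<close>, and one reversed denominator; modulo 2 they add up to M + j +
      p.\<close>
    have KB: "B j p = (-1) ^ (M + j + p) * K j p" if j: "j \<in> I" and p: "p \<in> I" for j p
    proof -
      have "\<omega> j = (real (n j - m) - real (n p)) * (\<Prod>s\<in>{..<N} - {p}. real (n j - m) - real (n s))"
        unfolding \<omega>_def using p by (subst prod.remove[of _ p]) (auto simp: I_def)
      then have "B j p = b j * (\<omega> j / (real (n j - m) - real (n p)) / \<omega>' p)"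
        using less[OF p j] by (simp add: B_def prod_dividef \<omega>'_def)
      also have "\<dots> = - (b j * \<omega> j / (\<omega>' p * (real (n p) - real (n j - m))))"
      proof -
        have e: "real (n j - m) - real (n p) = - (real (n p) - real (n j - m))" by simp
        show ?thesis unfolding e divide_minus_right divide_minus_left mult_minus_right by (simp add: mult.commute)
      qed
      finally have B: "B j p = - (b j * \<omega> j / (\<omega>' p * (real (n p) - real (n j - m))))" .
      have par: "(-1::real) ^ x = - ((-1) ^ y)" if "even x \<longleftrightarrow> odd y" for x y
        using that by (auto simp: minus_one_power_iff)
      have "even (N - (j - M) + (N - Suc p)) \<longleftrightarrow> odd (M + j + p)"
        using \<omega>(2)[OF j] j p by (auto simp: I_def)
      note sgn = par[OF this, unfolded power_add[of _ "N - (j - M)"]]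
      have "K j p = ((-1) ^ (N - (j - M)) * (-1) ^ (N - Suc p)) * (b j * \<omega> j / (\<omega>' p * (real (n p) - real (n j - m))))"
        by (simp add: K_def a_def d_def divide_inverse minus_one_power_iff)
      then have "(-1) ^ (M + j + p) * K j p = ((-1) ^ (M + j + p) * (-1) ^ (M + j + p)) * B j p"
        unfolding sgn B by simp
      then show ?thesis by (simp flip: power_mult_distrib)
    qed
    have vd: "strictly_alternates I x r"
      if "\<exists>p\<in>I. x p \<noteq> 0" "weakly_alternates I (\<lambda>j. \<Sum>p\<in>I. K j p * x p) r" for x r
      using that(2) unfolding K_def
      by (rule cauchy_kernel_variation_diminishing[rotated -1])
        (use fin that(1) less apos dpos strict in \<open>auto simp: strict_mono_on_def strict_mono_def I_def\<close>)
    have KA: "(\<Sum>p\<in>I. of_real (K j p) * ((-1) ^ p * x p)) = (-1) ^ (M + j) * (\<Sum>p<N. A j p * x p)"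
      if j: "j \<in> I" and x: "\<And>p. p < N \<Longrightarrow> p \<notin> I \<Longrightarrow> x p = 0" for j and x :: "nat \<Rightarrow> complex"
    proof -
      have "(\<Sum>p<N. A j p * x p) = (\<Sum>p\<in>I. A j p * x p)"
        using x by (intro sum.mono_neutral_right) (auto simp: I_def)
      also have "\<dots> = (\<Sum>p\<in>I. (-1) ^ (M + j) * (of_real (K j p) * ((-1) ^ p * x p)))"
        unfolding AB using KB[OF j] by (intro sum.cong refl) (simp add: power_add mult_ac)
      finally show ?thesis
        unfolding sum_distrib_left[symmetric] by (simp flip: mult.assoc power_mult_distrib)
    qed
    show False
    \<comment> \<open>The sign (-1)^p is absorbed into the vectors and (-1)^M into the
      eigenvalue.\<close>
    proof (rule no_defective_eigenvalue[OF fin q vd])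
      show "(-1) ^ M * c \<noteq> 0" using c by simp
      show "\<exists>p\<in>I. (-1) ^ p * h p \<noteq> 0" "\<exists>p\<in>I. (-1) ^ p * f p \<noteq> 0" "(-1) ^ q * f q = 0"
        using hI fI f(2) by auto
      show "(\<Sum>p\<in>I. of_real (K j p) * ((-1) ^ p * h p)) = (-1) ^ M * c * ((-1) ^ j * h j)" if "j \<in> I" for j
      proof -
        have "j < N" using that by (simp add: I_def)
        then show ?thesis using KA[where x = h, OF that h0] h(2)[of j] by (simp add: power_add)
      qed
      show "(\<Sum>p\<in>I. of_real (K j p) * ((-1) ^ p * f p)) =
          (-1) ^ M * c * ((-1) ^ j * f j) + (-1) ^ M * \<beta> * ((-1) ^ j * h j)" if "j \<in> I" for j
      proof -
        have "j < N" using that by (simp add: I_def)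
        then show ?thesis using KA[where x = f, OF that f0] f(3)[of j] by (simp add: power_add algebra_simps)
      qed
    qed
  qed
qed

section \<open>The normalising constant and the combination of the cases\<close>

lemma wh_const_nonzero:
  assumes "k \<ge> 1"
  shows "wh_const N k l \<noteq> 0"
proof -
  have "of_nat (jump_index k l j) - of_nat (jump_index k l i) \<noteq> (0::complex)" if "1 \<le> i" "i < j" for i j
  proof -
    have "(i - 1) * k < (j - 1) * k" using that assms by simp
    then show ?thesis by (auto simp: jump_index_def simp del: of_nat_add of_nat_mult)
  qed
  then have "(\<Prod>(i, j) \<in> {(i, j). 1 \<le> i \<and> i < j \<and> j \<le> N}.
      of_nat (jump_index k l j) - of_nat (jump_index k l i)) \<noteq> (0::complex)"
    \<comment> \<open>A product over an infinite set is 1 by convention, so both cases give a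
      nonzero value.\<close>
    by (cases "finite {(i, j). 1 \<le> i \<and> i < j \<and> j \<le> N}") (auto simp: prod_zero_iff)
  then show ?thesis by (simp add: wh_const_def)
qed

theorem theorem1p1:
  fixes N m k l :: nat
  assumes "N \<ge> 1" and "m \<ge> 2" and "k \<ge> 2" and "1 \<le> l" and "l \<le> k - 1"
    and "(N = 2 \<and> m > jump_index k l 1)
       \<or> (N \<ge> 3 \<and> real m > real (jump_index k l N) / 2)
       \<or> (k = 4 \<and> m = 2)"
  shows "\<forall>z::complex. z \<noteq> 0 \<and> poly (WH_poly N m k l) z = 0 \<longrightarrow> Polynomial.order z (WH_poly N m k l) = 1"
proof (intro allI impI, elim conjE)
  fix z :: complex
  assume z: "z \<noteq> 0" "poly (WH_poly N m k l) z = 0"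
  define fs where "fs = map (\<lambda>i. pgen m (jump_index k l i)) [1..<N + 1]"
  have W: "WH_poly N m k l = Polynomial.smult (wh_const N k l) (wronskian fs)"
    by (simp add: WH_poly_def fs_def)
  have c: "wh_const N k l \<noteq> 0" using assms(3) by (intro wh_const_nonzero) simp
  have len: "length fs = N" by (simp add: fs_def)
  \<comment> \<open>The list starts at index 1, so position \<open>j\<close> holds the polynomial of
    index n_(j+1) = l + j k.\<close>
  have nth: "fs ! j = pgen m (l + j * k)" if "j < N" for j
    using that by (simp add: fs_def jump_index_def del: upt_Suc)
  have W0: "poly (wronskian fs) z = 0" using z(2) c by (simp add: W)
  have "poly (pderiv (wronskian fs)) z \<noteq> 0"
  proof
    assume W1: "poly (pderiv (wronskian fs)) z = 0"
    from assms(6) show False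
    proof (elim disjE conjE)
      assume "N = 2" "m > jump_index k l 1"
      moreover have "fs = [pgen m l, pgen m (l + k)]"
        using nth[of 0] nth[of 1] len \<open>N = 2\<close> by (auto intro!: nth_equalityI simp: less_2_cases_iff)
      ultimately show False
        using wronskian_double_root_two[of m l "l + k" z] assms z W0 W1 by (simp add: jump_index_def)
    next
      assume "N \<ge> 3" "real m > real (jump_index k l N) / 2"
      then have "real (jump_index k l N) < real (2 * m)" by simp
      then have top: "l + (N - 1) * k < 2 * m" unfolding of_nat_less_iff jump_index_def .
      have "l + j * k < 2 * m" if "j < N" for j
        using mult_le_mono1[of j "N - 1" k] that top by linarith
      moreover have "k \<ge> 1" "l < k" "m \<ge> 1" using assms(2-5) by auto
      ultimately show False
        using wronskian_double_root_short[OF _ _ _ z(1) _ len nth W0 W1] by blast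
    next
      assume "k = 4" "m = 2"
      then show False
        using wronskian_double_root_jump_4[of l z fs N] assms z(1) len nth W0 W1 by (simp add: mult.commute)
    qed
  qed
  then show "Polynomial.order z (WH_poly N m k l) = 1"
    using order_eq_1I[OF z(2)] c by (simp add: W pderiv_smult)
qed

end
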